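(* Let every square of the tiling $\{S_k\}_{k\ge 0}$ be either occupied or vacant, with $S_0$ occupied, and suppose that the plus connected occupied component $C^+(0)$ containing the origin is finite. Let $\Lambda_0^+$ denote the set of all vacant squares that are plus adjacent to (share an edge with) some occupied square of $C^+(0)$. Then there exists a unique star connected $S$-cycle $H_{out}=(U_1,\dots,U_q)$ with the following properties: (i) For every $i$, $1\le i\le q$, the square $U_i$ is in $\Lambda_0^+$. (ii) The outermost boundary of $H_{out}$ is a single cycle $\partial_H$, and every square in $H_{out}$ has an edge in $\partial_H$. (iii) Every occupied square in $C^+(0)$ is contained in the interior of $\partial_H$, and every vacant square in $\Lambda_0^+$ is contained in the interior of $\partial_H$.
   Context: Tile $\mathbb{R}^2$ into unit squares $\{S_k\}_{k\ge 0}$ (disjoint except for shared edges and corners), with the origin being the centre of $S_0$. Two distinct squares are star adjacent if they share a corner, and plus adjacent if they share an edge. (Plus adjacent squares are also star adjacent.) $C^+(0)$ is the collection of all occupied squares connected to $S_0$ by an occupied plus connected path, i.e. a sequence of distinct occupied squares in which consecutive squares are plus adjacent. A star connected $S$-path is a sequence of distinct squares $(Q_1,\dots,Q_n)$ such that $Q_i$ is star adjacent to $Q_{i+1}$ for $1\le i\le n-1$. A star connected $S$-cycle is a sequence $(Q_1,\dots,Q_n)$ of distinct squares with $n\ge 3$ which is a star connected $S$-path and for which $Q_n$ is also star adjacent to $Q_1$. $S$-cycles that differ only by cyclic rotation or reversal of the sequence are identified. Graph and cycles: for a collection $A$ of squares, let $G_A$ be the graph whose vertices are the corners of the squares in $A$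 and whose edges are the (unit length) edges of the squares in $A$. A cycle in $G_A$ is a closed path of distinct edges without repeated vertices (a simple closed lattice polygon). A cycle divides the plane into a bounded region, its interior, and an unbounded region, its exterior. A square is contained in the interior (exterior) of a cycle if its open unit square lies in the interior (exterior) region. An edge lies in the interior (exterior) of a cycle if both of the squares of $\{S_k\}$ having it as an edge lie in the interior (exterior) of the cycle. Outermost boundary: an edge $e$ of $G_A$ is an outermost boundary edge of $A$ if for every cycle $C$ in $G_A$, either $e$ is an edge of $C$ or $e$ lies in the exterior of $C$. The outermost boundary of $A$ is the set of all outermost boundary edges of $A$. The outermost boundary of an $S$-cycle is the outermost boundary of the set of squares in it. *)

theory Defs
  imports "HOL-Analysis.Analysis"
begin

text \<open>
  The plane is modelled by \<^typ>\<open>complex\<close> (as in the library's Jordan curve theorem), and the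
  tile centred at the lattice point \<open>(i, j)\<close> by its centre; \<open>(0, 0)\<close> is the tile \<open>S\<^sub>0\<close>.
\<close>

type_synonym square = "int \<times> int"

fun open_square :: "square \<Rightarrow> complex set" where
  "open_square (i, j) =
     box (Complex (of_int i - 1/2) (of_int j - 1/2)) (Complex (of_int i + 1/2) (of_int j + 1/2))"

fun corners :: "square \<Rightarrow> complex set" where
  "corners (i, j) =
     {Complex (of_int i + a) (of_int j + b) | a b. a \<in> {-1/2, 1/2} \<and> b \<in> {-1/2, 1/2}}"

text \<open>An edge is represented by the set of its two endpoints; its trace is the convex hull.\<close>

type_synonym edge = "complex set"

definition edges :: "square \<Rightarrow> edge set" where
  "edges s = {{u, v} | u v. u \<in> corners s \<and> v \<in> corners s \<and> dist u v = 1}"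

definition star_adjacent :: "square \<Rightarrow> square \<Rightarrow> bool" where
  "star_adjacent s t \<longleftrightarrow> s \<noteq> t \<and> corners s \<inter> corners t \<noteq> {}"

definition plus_adjacent :: "square \<Rightarrow> square \<Rightarrow> bool" where
  "plus_adjacent s t \<longleftrightarrow> s \<noteq> t \<and> edges s \<inter> edges t \<noteq> {}"


text \<open>A configuration is given by the set \<open>occ\<close> of occupied squares; all others are vacant.\<close>

definition occupied_plus_path :: "square set \<Rightarrow> square list \<Rightarrow> bool" where
  "occupied_plus_path occ p \<longleftrightarrow>
     p \<noteq> [] \<and> distinct p \<and> set p \<subseteq> occ \<and> successively plus_adjacent p"

definition plus_component :: "square set \<Rightarrow> square set" where
  "plus_component occ =
     {s. \<exists>p. occupied_plus_path occ p \<and> hd p = (0, 0) \<and> last p = s}"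

definition vacant_boundary :: "square set \<Rightarrow> square set" where
  "vacant_boundary occ = {t. t \<notin> occ \<and> (\<exists>s \<in> plus_component occ. plus_adjacent t s)}"


definition star_path :: "square list \<Rightarrow> bool" where
  "star_path Q \<longleftrightarrow> distinct Q \<and> successively star_adjacent Q"

definition star_cycle :: "square list \<Rightarrow> bool" where
  "star_cycle Q \<longleftrightarrow> length Q \<ge> 3 \<and> star_path Q \<and> star_adjacent (last Q) (hd Q)"

definition same_cycle :: "square list \<Rightarrow> square list \<Rightarrow> bool" where
  "same_cycle P Q \<longleftrightarrow> (\<exists>k. Q = rotate k P \<or> Q = rotate k (rev P))"


definition graph_edges :: "square set \<Rightarrow> edge set" where
  "graph_edges A = (\<Union>s\<in>A. edges s)"

definition closed_path_edges :: "complex list \<Rightarrow> edge set" where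
  "closed_path_edges vs = {{vs ! i, vs ! (Suc i mod length vs)} | i. i < length vs}"

text \<open>
  A cycle of \<open>G\<^sub>A\<close> is identified with its set of edges. For distinct vertices, the bound on the
  length is what makes the edges traversed distinct (it excludes going back and forth on one edge).
\<close>

definition is_cycle :: "square set \<Rightarrow> edge set \<Rightarrow> bool" where
  "is_cycle A C \<longleftrightarrow>
     (\<exists>vs. length vs \<ge> 3 \<and> distinct vs \<and> C = closed_path_edges vs \<and> C \<subseteq> graph_edges A)"

definition cycle_trace :: "edge set \<Rightarrow> complex set" where
  "cycle_trace C = (\<Union>e\<in>C. convex hull e)"

definition square_in_interior :: "edge set \<Rightarrow> square \<Rightarrow> bool" where
  "square_in_interior C s \<longleftrightarrow> open_square s \<subseteq> inside (cycle_trace C)"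

definition square_in_exterior :: "edge set \<Rightarrow> square \<Rightarrow> bool" where
  "square_in_exterior C s \<longleftrightarrow> open_square s \<subseteq> outside (cycle_trace C)"

definition edge_in_exterior :: "edge set \<Rightarrow> edge \<Rightarrow> bool" where
  "edge_in_exterior C e \<longleftrightarrow> (\<forall>s. e \<in> edges s \<longrightarrow> square_in_exterior C s)"

definition outermost_boundary :: "square set \<Rightarrow> edge set" where
  "outermost_boundary A =
     {e \<in> graph_edges A. \<forall>C. is_cycle A C \<longrightarrow> e \<in> C \<or> edge_in_exterior C e}"


definition outer_vacant_cycle :: "square set \<Rightarrow> square list \<Rightarrow> bool" where
  "outer_vacant_cycle occ H \<longleftrightarrow>
     star_cycle H \<and>
     set H \<subseteq> vacant_boundary occ \<and>
     (let B = outermost_boundary (set H) in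
        is_cycle (set H) B \<and>
        (\<forall>s \<in> set H. edges s \<inter> B \<noteq> {}) \<and>
        (\<forall>s \<in> plus_component occ. square_in_interior B s) \<and>
        (\<forall>s \<in> vacant_boundary occ. square_in_interior B s))"

end

theory Submission
  imports Defs
begin

text \<open>
  Let \<open>C\<close> be the occupied component of the origin and \<open>L\<close> its vacant boundary. Fill the holes of
  \<open>C \<union> L\<close>: let \<open>F\<close> be the complement of the unbounded plus component of the complement of
  \<open>C \<union> L\<close>. Then \<open>F\<close> is finite, and both \<open>F\<close> and its complement are plus connected. The cycle
  sought is formed by the tiles of \<open>F\<close> with a side on the boundary \<open>D\<close> of \<open>F\<close>, taken in the
  order in which \<open>D\<close> meets them. Such a tile has a neighbour outside \<open>F\<close>, so it is not in a
  hole. It is not in \<open>C\<close> either, for the neighbours of \<open>C\<close> lie in \<open>C \<union> L \<subseteq> F\<close>. So it is in \<open>L\<close>.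

  The planar topology needed is a discrete substitute for the Jordan curve theorem: every closed
  trail of lattice edges splits the tiles into two classes, such that two tiles sharing an edge
  are in different classes iff the trail uses that edge an odd number of times
  (\<open>closed_trail_separates\<close>). The class of a tile is the parity of the number of trail edges met
  by a vertical ray from its centre.

  This parity has two uses. First, \<open>D\<close> is a simple cycle (\<open>boundary_is_simple_cycle\<close>): every
  vertex of \<open>D\<close> has degree at least two, so \<open>D\<close> contains a simple cycle; the connected sets \<open>F\<close>
  and its complement do not cross \<open>D\<close>, hence are the two classes of that cycle, and the cycle is
  all of \<open>D\<close>. Secondly, suppose that two tiles on \<open>D\<close> coincide or touch. An arc of \<open>D\<close> between
  them, closed up along their own sides, is a trail that neither \<open>C\<close> nor the complement of \<open>F\<close>
  crosses. Each further tile on \<open>D\<close> touches both of these connected sets, and this forces all of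
  them onto one and the same arc (\<open>crosscut\<close>). Hence no tile is met by \<open>D\<close> on two separate
  occasions, and two tiles on \<open>D\<close> that are star adjacent are consecutive on \<open>D\<close>: the tiles on
  \<open>D\<close> form a star cycle without chords.

  The outermost boundary of these tiles is \<open>D\<close>, because the complement of \<open>F\<close> is connected and
  infinite and so lies in the exterior of every cycle made of sides of tiles of \<open>F\<close>
  (\<open>boundary_edge_outermost\<close>), while \<open>F\<close> itself lies in the interior of \<open>D\<close>
  (\<open>boundary_encloses\<close>).

  For uniqueness, let \<open>H'\<close> be a second cycle with the required properties. Its outermost
  boundary encloses \<open>L\<close>, and comparison with \<open>D\<close> shows that it equals \<open>D\<close>
  (\<open>outermost_boundary_determined\<close>). So \<open>H'\<close> has the same tiles as the first cycle, and since
  that one has no chords, a star cycle through all of its tiles can only be the same cycle up to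
  rotation and reversal (\<open>hamiltonian_cycle_unique\<close>).
\<close>

section \<open>Lattice edges and adjacency\<close>

text \<open>
  Integer coordinates for vertices and edges: \<open>corner a b\<close>, \<open>hor a b\<close> and \<open>ver a b\<close> are the
  lower left corner, the bottom side and the left side of the tile \<open>(a, b)\<close>. All incidences then
  become linear statements about integers.
\<close>

definition corner :: "int \<Rightarrow> int \<Rightarrow> complex" where
  "corner a b = Complex (of_int a - 1/2) (of_int b - 1/2)"

definition hor :: "int \<Rightarrow> int \<Rightarrow> edge" where
  "hor a b = {corner a b, corner (a + 1) b}"

definition ver :: "int \<Rightarrow> int \<Rightarrow> edge" where
  "ver a b = {corner a b, corner a (b + 1)}"

lemma corner_eq_iff [simp]: "corner a b = corner a' b' \<longleftrightarrow> a = a' \<and> b = b'"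
  by (simp add: corner_def)

lemma corners_eq:
  "corners (i, j) = {corner i j, corner (i + 1) j, corner i (j + 1), corner (i + 1) (j + 1)}"
proof -
  have "{f a b | a b. a \<in> {x, y} \<and> b \<in> {x, y}} = {f x x, f y x, f x y, f y y}"
    for f :: "real \<Rightarrow> real \<Rightarrow> complex" and x y
    by blast
  note this[of "\<lambda>a b. Complex (of_int i + a) (of_int j + b)" "-1/2" "1/2"]
  then show ?thesis
    unfolding corners.simps by (simp only:) (simp add: corner_def add.commute)
qed

declare corners.simps [simp del] corners_eq [simp]

lemma dist_corner_eq_1:
  "dist (corner a b) (corner a' b') = 1 \<longleftrightarrow> \<bar>a - a'\<bar> + \<bar>b - b'\<bar> = 1"
proof -
  have "dist (corner a b) (corner a' b') = sqrt (of_int ((a - a')\<^sup>2 + (b - b')\<^sup>2))"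
    by (simp add: corner_def dist_norm complex_diff cmod_def)
  also have "\<dots> = 1 \<longleftrightarrow> (of_int ((a - a')\<^sup>2 + (b - b')\<^sup>2) :: real) = 1"
    by (rule real_sqrt_eq_1_iff)
  also have "\<dots> \<longleftrightarrow> (a - a')\<^sup>2 + (b - b')\<^sup>2 = 1"
    by linarith
  also have "\<dots> \<longleftrightarrow> \<bar>a - a'\<bar> + \<bar>b - b'\<bar> = 1"
  proof
    assume *: "(a - a')\<^sup>2 + (b - b')\<^sup>2 = 1"
    have "(a - a')\<^sup>2 \<ge> 0" "(b - b')\<^sup>2 \<ge> 0" by auto
    with * have "(a - a')\<^sup>2 = 0 \<and> (b - b')\<^sup>2 = 1 \<or> (a - a')\<^sup>2 = 1 \<and> (b - b')\<^sup>2 = 0"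
      by linarith
    then show "\<bar>a - a'\<bar> + \<bar>b - b'\<bar> = 1"
      by (auto simp: power2_eq_1_iff)
  next
    assume "\<bar>a - a'\<bar> + \<bar>b - b'\<bar> = 1"
    then have "a - a' = 0 \<and> \<bar>b - b'\<bar> = 1 \<or> \<bar>a - a'\<bar> = 1 \<and> b - b' = 0"
      by linarith
    then show "(a - a')\<^sup>2 + (b - b')\<^sup>2 = 1"
      by (metis add_0 add.right_neutral power2_abs power_one zero_power2)
  qed
  finally show ?thesis .
qed

lemma edges_eq: "edges (i, j) = {hor i j, hor i (j + 1), ver i j, ver (i + 1) j}"
proof (intro set_eqI iffI)
  fix e assume "e \<in> edges (i, j)"
  then obtain u v where uv: "e = {u, v}" "u \<in> corners (i, j)" "v \<in> corners (i, j)" "dist u v = 1"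
    unfolding edges_def by blast
  from uv(2,3,4) show "e \<in> {hor i j, hor i (j + 1), ver i j, ver (i + 1) j}"
    unfolding corners_eq
    by (elim insertE emptyE) (simp_all add: uv(1) hor_def ver_def dist_corner_eq_1 insert_commute)
next
  have mem: "{u, v} \<in> edges (i, j)" if "u \<in> corners (i, j)" "v \<in> corners (i, j)" "dist u v = 1" for u v
    using that unfolding edges_def by blast
  fix e assume "e \<in> {hor i j, hor i (j + 1), ver i j, ver (i + 1) j}"
  then show "e \<in> edges (i, j)"
    by (elim insertE emptyE) (simp_all add: hor_def ver_def mem dist_corner_eq_1)
qed

lemma hor_ver_eq_iff [simp]:
  "hor a b = hor a' b' \<longleftrightarrow> a = a' \<and> b = b'"
  "ver a b = ver a' b' \<longleftrightarrow> a = a' \<and> b = b'"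
  "hor a b \<noteq> ver a' b'" "ver a b \<noteq> hor a' b'"
  by (auto simp: hor_def ver_def doubleton_eq_iff)

lemma hor_in_edges_iff: "hor a b \<in> edges s \<longleftrightarrow> s = (a, b) \<or> s = (a, b - 1)"
  by (cases s) (auto simp: edges_eq)

lemma ver_in_edges_iff: "ver a b \<in> edges s \<longleftrightarrow> s = (a, b) \<or> s = (a - 1, b)"
  by (cases s) (auto simp: edges_eq)

lemma edge_cases:
  assumes "e \<in> edges s"
  obtains a b where "e = hor a b" | a b where "e = ver a b"
  using assms by (cases s) (auto simp: edges_eq)

text \<open>
  Used to show that an edge joining two tiles of some class is no side of a tile outside this
  class.
\<close>

lemma edge_on_two_squares:
  assumes "e \<in> edges s" "e \<in> edges t" "s \<noteq> t" "e \<in> edges r"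
  shows "r = s \<or> r = t"
  using assms(1)
  by (rule edge_cases) (use assms in \<open>auto simp: hor_in_edges_iff ver_in_edges_iff\<close>)

lemma plus_adjacent_iff: "plus_adjacent (i, j) (k, l) \<longleftrightarrow> \<bar>i - k\<bar> + \<bar>j - l\<bar> = 1"
proof -
  have "plus_adjacent (i, j) (k, l) \<longleftrightarrow> (i, j) \<noteq> (k, l) \<and> (\<exists>e \<in> edges (i, j). e \<in> edges (k, l))"
    unfolding plus_adjacent_def by blast
  also have "\<dots> \<longleftrightarrow> k = i \<and> (l = j + 1 \<or> l = j - 1) \<or> l = j \<and> (k = i + 1 \<or> k = i - 1)"
    unfolding edges_eq[of i j] by (simp add: hor_in_edges_iff ver_in_edges_iff) presburger
  also have "\<dots> \<longleftrightarrow> \<bar>i - k\<bar> + \<bar>j - l\<bar> = 1"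
    by linarith
  finally show ?thesis .
qed

lemma plus_adjacent_sym: "plus_adjacent s t \<longleftrightarrow> plus_adjacent t s"
  unfolding plus_adjacent_def by auto

lemma plus_adjacentE:
  assumes "plus_adjacent s t"
  obtains e where "e \<in> edges s" "e \<in> edges t" "s \<noteq> t"
  using assms unfolding plus_adjacent_def by auto

lemma plus_adjacentI: "e \<in> edges s \<Longrightarrow> e \<in> edges t \<Longrightarrow> s \<noteq> t \<Longrightarrow> plus_adjacent s t"
  unfolding plus_adjacent_def by auto

lemma star_adjacent_sym: "star_adjacent s t \<longleftrightarrow> star_adjacent t s"
  unfolding star_adjacent_def by auto

lemma edge_subset_corners: "e \<in> edges s \<Longrightarrow> e \<subseteq> corners s"
  unfolding edges_def by auto

section \<open>Closed trails separate the tiles by parity\<close>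

text \<open>
  Only edges are recorded, so that concatenation of trails is concatenation of lists; repeated
  edges are allowed, because the argument below counts them modulo two.
\<close>

fun trail :: "complex \<Rightarrow> edge list \<Rightarrow> complex \<Rightarrow> bool" where
  "trail x [] y \<longleftrightarrow> x = y"
| "trail x (e # es) y \<longleftrightarrow> (\<exists>z. e = {x, z} \<and> e \<in> graph_edges UNIV \<and> trail z es y)"

lemma trail_append: "trail x es y \<Longrightarrow> trail y fs z \<Longrightarrow> trail x (es @ fs) z"
  by (induction es arbitrary: x) auto

lemma trail_single: "{x, y} \<in> edges s \<Longrightarrow> trail x [{x, y}] y"
  by (auto simp: graph_edges_def simp del: split_paired_Ex)

lemma trail_rev: "trail x es y \<Longrightarrow> trail y (rev es) x"
proof (induction es arbitrary: x)
  case (Cons e es)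
  then obtain z where z: "e = {x, z}" "e \<in> graph_edges UNIV" "trail y (rev es) z"
    by auto
  have "trail z [e] x"
    using z(1,2) by (simp add: insert_commute)
  from trail_append[OF z(3) this] show ?case by simp
qed auto

text \<open>
  The edges met by the upward vertical ray from the centre of the tile \<open>(i, j)\<close>.
\<close>

definition crossings :: "int \<Rightarrow> int \<Rightarrow> edge list \<Rightarrow> nat" where
  "crossings i j es = length (filter (\<lambda>e. \<exists>b > j. e = hor i b) es)"

lemma crossings_Cons:
  "crossings i j (e # es) = (if \<exists>b > j. e = hor i b then 1 else 0) + crossings i j es"
  by (simp add: crossings_def)

lemma crossings_below: "crossings i (j - 1) es = crossings i j es + count_list es (hor i j)"
proof (induction es)
  case Nil
  then show ?case by (simp add: crossings_def)
next
  case (Cons e es)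
  have "b > j - 1 \<longleftrightarrow> b > j \<or> b = j" for b
    by linarith
  then have "(\<exists>b > j - 1. e = hor i b) \<longleftrightarrow> (\<exists>b > j. e = hor i b) \<or> e = hor i j"
    by auto
  then show ?case
    using Cons by (auto simp: crossings_Cons)
qed

text \<open>
  The rays upwards from the centres of the adjacent tiles \<open>(i, j)\<close> and \<open>(i + 1, j)\<close> enclose a
  half strip whose bottom meets the lattice only in the edge \<open>ver (i + 1) j\<close> and which contains
  exactly the vertices in \<open>R\<close>. An edge joins a vertex of \<open>R\<close> to one outside \<open>R\<close> iff it crosses
  one of the two rays or the bottom, so a trail does this an even number of times iff it starts
  and ends on the same side.
\<close>

lemma trail_crossings_parity:
  fixes i j :: int
  assumes "trail x es y"
  defines "R \<equiv> {corner (i + 1) b | b. b > j}"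
  shows "even (crossings i j es + crossings (i + 1) j es + count_list es (ver (i + 1) j))
    \<longleftrightarrow> (x \<in> R \<longleftrightarrow> y \<in> R)"
  using assms(1)
proof (induction es arbitrary: x)
  case Nil
  then show ?case by (simp add: crossings_def)
next
  case (Cons e es)
  then obtain z s where z: "e = {x, z}" "e \<in> edges s" "trail z es y"
    by (auto simp: graph_edges_def)
  note IH = Cons.IH[OF z(3)]
  \<comment> \<open>Each end of an edge can be tested for membership in \<open>R\<close> from its coordinates.\<close>
  have toggle: "(x \<in> R \<longleftrightarrow> z \<in> R) \<longleftrightarrow>
     \<not> ((\<exists>b > j. e = hor i b) \<or> (\<exists>b > j. e = hor (i + 1) b) \<or> e = ver (i + 1) j)"
    using z(2)
  proof (cases rule: edge_cases)
    case (1 a b)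
    then have "x = corner a b \<and> z = corner (a+1) b \<or> z = corner a b \<and> x = corner (a+1) b"
      using z(1) by (auto simp: hor_def doubleton_eq_iff)
    then show ?thesis using 1 by (auto simp: R_def)
  next
    case (2 a b)
    then have "x = corner a b \<and> z = corner a (b+1) \<or> z = corner a b \<and> x = corner a (b+1)"
      using z(1) by (auto simp: ver_def doubleton_eq_iff)
    then show ?thesis using 2 by (auto simp: R_def)
  qed
  define p q r where pqr: "p \<longleftrightarrow> (\<exists>b > j. e = hor i b)"
    "q \<longleftrightarrow> (\<exists>b > j. e = hor (i + 1) b)" "r \<longleftrightarrow> e = ver (i + 1) j"
  have one: "\<not> (p \<and> q)" "\<not> (p \<and> r)" "\<not> (q \<and> r)"
    by (auto simp: pqr)
  show ?case
    using IH toggle one unfolding crossings_Cons count_list.simps pqr[symmetric]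
    by (cases p; cases q; cases r; cases "z \<in> R"; simp)
qed

text \<open>
  The discrete replacement for the Jordan curve theorem. Crossing a horizontal edge changes the
  ray of a tile by this one edge. For a vertical edge, the half strip argument applies, and a
  closed trail enters and leaves the half strip equally often.
\<close>

lemma closed_trail_separates:
  assumes "trail x es x"
  shows "\<exists>I. \<forall>s t e. e \<in> edges s \<longrightarrow> e \<in> edges t \<longrightarrow> s \<noteq> t \<longrightarrow>
    ((s \<in> I \<longleftrightarrow> t \<in> I) \<longleftrightarrow> even (count_list es e))"
proof -
  define I where "I = {(i, j). odd (crossings i j es)}"
  have h: "((a, b) \<in> I \<longleftrightarrow> (a, b - 1) \<in> I) \<longleftrightarrow> even (count_list es (hor a b))" for a b
    by (auto simp: I_def crossings_below)
  have v: "((a, b) \<in> I \<longleftrightarrow> (a - 1, b) \<in> I) \<longleftrightarrow> even (count_list es (ver a b))" for a b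
    using trail_crossings_parity[OF assms, of "a - 1" b] by (auto simp: I_def)
  show ?thesis
  proof (intro exI[of _ I] allI impI)
    fix s t e assume *: "e \<in> edges s" "e \<in> edges t" "s \<noteq> t"
    from *(1) show "(s \<in> I \<longleftrightarrow> t \<in> I) \<longleftrightarrow> even (count_list es e)"
    proof (cases rule: edge_cases)
      case (1 a b)
      then show ?thesis using * h[of a b] by (auto simp: hor_in_edges_iff)
    next
      case (2 a b)
      then show ?thesis using * v[of a b] by (auto simp: ver_in_edges_iff)
    qed
  qed
qed

text \<open>
  The sides of a tile form a connected graph: every corner is joined to the lower left one.
\<close>

lemma trail_in_square:
  assumes "a \<in> corners s" "b \<in> corners s"
  obtains es where "trail a es b" "set es \<subseteq> edges s"
proof -
  obtain i j where s: "s = (i, j)" by (cases s)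
  have "\<exists>es. trail p es (corner i j) \<and> set es \<subseteq> edges s" if p: "p \<in> corners s" for p
  proof -
    have e: "{corner (i+1) j, corner i j} \<in> edges s" "{corner i (j+1), corner i j} \<in> edges s"
      "{corner (i+1) (j+1), corner (i+1) j} \<in> edges s"
      by (simp_all add: s edges_eq hor_def ver_def insert_commute)
    have t: "trail (corner (i+1) (j+1)) [{corner (i+1) (j+1), corner (i+1) j}, {corner (i+1) j, corner i j}] (corner i j)"
      using trail_append[OF trail_single[OF e(3)] trail_single[OF e(1)]] by simp
    have "trail (corner i j) [] (corner i j)"
      by simp
    moreover have "p = corner i j \<or> p = corner (i+1) j \<or> p = corner i (j+1) \<or> p = corner (i+1) (j+1)"
      using p by (simp add: s)
    ultimately show ?thesis
      using trail_single[OF e(1)] trail_single[OF e(2)] t e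
      by (metis empty_iff empty_set insert_iff list.simps(15) subsetI)
  qed
  then obtain es fs where *: "trail a es (corner i j)" "set es \<subseteq> edges s"
      "trail b fs (corner i j)" "set fs \<subseteq> edges s"
    using assms by meson
  show thesis
    using that[of "es @ rev fs"] trail_append[OF *(1) trail_rev[OF *(3)]] *(2,4) by simp
qed

section \<open>Plus connected regions and their boundaries\<close>

definition plus_steps :: "square set \<Rightarrow> (square \<times> square) set" where
  "plus_steps X = {(s, t). s \<in> X \<and> t \<in> X \<and> plus_adjacent s t}"

definition plus_connected :: "square set \<Rightarrow> bool" where
  "plus_connected X \<longleftrightarrow> (\<forall>s\<in>X. \<forall>t\<in>X. (s, t) \<in> (plus_steps X)\<^sup>*)"

lemma plus_connected_invariant:
  assumes "plus_connected X"
    and step: "\<And>s t. s \<in> X \<Longrightarrow> t \<in> X \<Longrightarrow> plus_adjacent s t \<Longrightarrow> P s \<Longrightarrow> P t"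
    and "s \<in> X" "t \<in> X" "P s"
  shows "P t"
proof -
  have "(s, t) \<in> (plus_steps X)\<^sup>*"
    using assms unfolding plus_connected_def by blast
  then show ?thesis
    by (induction rule: rtrancl_induct) (use assms in \<open>auto simp: plus_steps_def\<close>)
qed

definition boundary_edges :: "square set \<Rightarrow> edge set" where
  "boundary_edges F = {e. \<exists>s t. s \<in> F \<and> t \<notin> F \<and> e \<in> edges s \<and> e \<in> edges t}"

lemma boundary_edges_hor [simp]:
  "hor a b \<in> boundary_edges F \<longleftrightarrow> ((a, b) \<in> F \<longleftrightarrow> (a, b - 1) \<notin> F)"
  unfolding boundary_edges_def mem_Collect_eq hor_in_edges_iff by blast

lemma boundary_edges_ver [simp]:
  "ver a b \<in> boundary_edges F \<longleftrightarrow> ((a, b) \<in> F \<longleftrightarrow> (a - 1, b) \<notin> F)"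
  unfolding boundary_edges_def mem_Collect_eq ver_in_edges_iff by blast

lemma boundary_edgesE:
  assumes "e \<in> boundary_edges F"
  obtains s t where "s \<in> F" "t \<notin> F" "e \<in> edges s" "e \<in> edges t"
  using assms unfolding boundary_edges_def by blast

lemma boundary_edges_subset: "boundary_edges F \<subseteq> graph_edges F"
  unfolding boundary_edges_def graph_edges_def by blast

lemma graph_edges_mono: "A \<subseteq> B \<Longrightarrow> graph_edges A \<subseteq> graph_edges B"
  unfolding graph_edges_def by blast

lemma finite_graph_edges: "finite A \<Longrightarrow> finite (graph_edges A)"
  unfolding graph_edges_def by (rule finite_UN_I) (auto simp: edges_eq)

text \<open>
  The four edges at a vertex separate the four tiles around it, in cyclic order. Going around
  the vertex, membership in \<open>F\<close> changes an even number of times, so the boundary cannot end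
  there.
\<close>

lemma boundary_edges_no_end:
  assumes "e \<in> boundary_edges F" "p \<in> e"
  shows "\<exists>e' \<in> boundary_edges F. e' \<noteq> e \<and> p \<in> e'"
proof -
  from assms(1) obtain s where s: "e \<in> edges s" by (blast elim: boundary_edgesE)
  have "\<exists>a b. p = corner a b \<and> e \<in> {hor a b, hor (a - 1) b, ver a b, ver a (b - 1)}"
    using s
  proof (cases rule: edge_cases)
    case (1 a b)
    then have "p = corner a b \<or> p = corner (a + 1) b"
      using assms(2) by (simp add: hor_def)
    then show ?thesis
    proof
      assume "p = corner (a + 1) b"
      then show ?thesis using 1 by (intro exI[of _ "a + 1"] exI[of _ b]) simp
    qed (use 1 in blast)
  next
    case (2 a b)
    then have "p = corner a b \<or> p = corner a (b + 1)"
      using assms(2) by (simp add: ver_def)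
    then show ?thesis
    proof
      assume "p = corner a (b + 1)"
      then show ?thesis using 2 by (intro exI[of _ a] exI[of _ "b + 1"]) simp
    qed (use 2 in blast)
  qed
  then obtain a b where p: "p = corner a b" and
    e: "e \<in> {hor a b, hor (a - 1) b, ver a b, ver a (b - 1)}" by blast
  have inc: "p \<in> hor a b" "p \<in> hor (a - 1) b" "p \<in> ver a b" "p \<in> ver a (b - 1)"
    by (simp_all add: p hor_def ver_def)
  \<comment> \<open>If \<open>e\<close> were the only boundary edge among the four, membership would change exactly once.\<close>
  have "\<exists>e' \<in> {hor a b, hor (a - 1) b, ver a b, ver a (b - 1)}. e' \<noteq> e \<and> e' \<in> boundary_edges F"
  proof (rule ccontr)
    assume "\<not> ?thesis"
    then have "e' \<in> boundary_edges F \<longleftrightarrow> e' = e"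
      if "e' \<in> {hor a b, hor (a - 1) b, ver a b, ver a (b - 1)}" for e'
      using that assms(1) by blast
    then have "hor a b \<in> boundary_edges F \<longleftrightarrow> e = hor a b"
      "hor (a - 1) b \<in> boundary_edges F \<longleftrightarrow> e = hor (a - 1) b"
      "ver a b \<in> boundary_edges F \<longleftrightarrow> e = ver a b"
      "ver a (b - 1) \<in> boundary_edges F \<longleftrightarrow> e = ver a (b - 1)"
      by blast+
    moreover have "(hor a b \<in> boundary_edges F \<longleftrightarrow> hor (a - 1) b \<in> boundary_edges F) \<longleftrightarrow>
        (ver a b \<in> boundary_edges F \<longleftrightarrow> ver a (b - 1) \<in> boundary_edges F)"
      unfolding boundary_edges_hor boundary_edges_ver by argo
    ultimately have "(e = hor a b \<longleftrightarrow> e = hor (a - 1) b) \<longleftrightarrow> (e = ver a b \<longleftrightarrow> e = ver a (b - 1))"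
      by (simp only:)
    with e show False
      by (elim insertE emptyE) simp_all
  qed
  then show ?thesis using inc by blast
qed

section \<open>The boundary of a region without holes is a simple cycle\<close>

definition cycle_edge :: "complex list \<Rightarrow> nat \<Rightarrow> edge" where
  "cycle_edge vs k = {vs ! k, vs ! (Suc k mod length vs)}"

lemma closed_path_edges_eq: "closed_path_edges vs = cycle_edge vs ` {..<length vs}"
  unfolding closed_path_edges_def cycle_edge_def by blast

lemma finite_closed_path_edges: "finite (closed_path_edges vs)"
  unfolding closed_path_edges_eq by simp

lemma cycle_edge_inj:
  assumes "distinct vs" "length vs \<ge> 3"
  shows "inj_on (cycle_edge vs) {..<length vs}"
proof (rule inj_onI)
  fix i j assume ij: "i \<in> {..<length vs}" "j \<in> {..<length vs}" "cycle_edge vs i = cycle_edge vs j"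
  let ?n = "length vs"
  have lt: "i < ?n" "j < ?n" "Suc i mod ?n < ?n" "Suc j mod ?n < ?n"
    using ij assms(2) by (auto intro!: mod_less_divisor)
  show "i = j"
  proof (rule ccontr)
    assume "i \<noteq> j"
    then have "vs ! i = vs ! (Suc j mod ?n)" "vs ! j = vs ! (Suc i mod ?n)"
      using ij lt assms(1) unfolding cycle_edge_def by (auto simp: doubleton_eq_iff nth_eq_iff_index_eq)
    then have "i = Suc j mod ?n" "j = Suc i mod ?n"
      using lt assms(1) by (auto simp: nth_eq_iff_index_eq)
    then show False
      using lt assms(2) by (auto simp: mod_Suc split: if_splits)
  qed
qed

text \<open>
  All neighbours of the first vertex of a longest path lie on the path; since this vertex is on
  a second edge, that edge closes a cycle.
\<close>

lemma graph_contains_cycle: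
  assumes "finite E" "E \<noteq> {}"
    and doubleton: "\<And>e. e \<in> E \<Longrightarrow> \<exists>x y. x \<noteq> y \<and> e = {x, y}"
    and no_end: "\<And>e p. e \<in> E \<Longrightarrow> p \<in> e \<Longrightarrow> \<exists>e' \<in> E. e' \<noteq> e \<and> p \<in> e'"
  shows "\<exists>vs. length vs \<ge> 3 \<and> distinct vs \<and> closed_path_edges vs \<subseteq> E"
proof -
  define path where
    "path p \<longleftrightarrow> length p \<ge> 2 \<and> distinct p \<and> successively (\<lambda>x y. {x, y} \<in> E) p" for p
  obtain e0 where "e0 \<in> E"
    using assms(2) by blast
  from doubleton[OF this] this obtain x y where xy: "x \<noteq> y" "{x, y} \<in> E"
    by blast
  have fin: "finite (\<Union>E)"
  proof (rule finite_Union[OF assms(1)])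
    fix e assume "e \<in> E"
    from doubleton[OF this] show "finite e" by auto
  qed
  have in_E: "set p \<subseteq> \<Union>E" if "path p" for p
  proof
    fix v assume "v \<in> set p"
    then obtain k where k: "k < length p" "v = p ! k" by (auto simp: in_set_conv_nth)
    have suc: "{p ! i, p ! Suc i} \<in> E" if "Suc i < length p" for i
      using that \<open>path p\<close> by (auto simp: path_def successively_conv_nth)
    show "v \<in> \<Union>E"
    proof (cases "Suc k < length p")
      case True
      then show ?thesis using suc[of k] k by blast
    next
      case False
      then have "k = Suc (k - 1)" "Suc (k - 1) < length p"
        using k \<open>path p\<close> by (auto simp: path_def)
      then show ?thesis using suc[of "k - 1"] k by (metis UnionI insertCI)
    qed
  qed
  have p0: "path [x, y]" using xy by (auto simp: path_def)
  have bound: "\<forall>p. path p \<longrightarrow> length p < Suc (card (\<Union>E))"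
    using card_mono[OF fin in_E] by (auto simp: path_def distinct_card[symmetric] le_imp_less_Suc)
  from ex_has_greatest_nat[of path "[x, y]" length, OF p0 bound]
  obtain p where p: "path p" and longest: "\<And>q. path q \<Longrightarrow> length q \<le> length p"
    by auto
  obtain u v q where q: "p = u # v # q"
    using p by (auto simp: path_def numeral_2_eq_2 Suc_le_length_iff)
  have uv: "{u, v} \<in> E" using p by (simp add: path_def q)
  from no_end[OF uv, of u] obtain e where e: "e \<in> E" "e \<noteq> {u, v}" "u \<in> e" by auto
  from doubleton[OF e(1)] obtain a b where ab: "a \<noteq> b" "e = {a, b}"
    by blast
  \<comment> \<open>The other end of the second edge at \<open>u\<close>.\<close>
  define w where "w = (if u = a then b else a)"
  have w: "w \<noteq> u" "e = {u, w}"
    using ab e(3) by (auto simp: w_def)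
  have "w \<in> set p"
  proof (rule ccontr)
    assume "w \<notin> set p"
    then have "path (w # p)"
      using p e w by (auto simp: path_def q insert_commute)
    then show False using longest[of "w # p"] by simp
  qed
  then obtain m where m: "m < length p" "p ! m = w" by (auto simp: in_set_conv_nth)
  have m2: "m \<ge> 2"
    using m w e(2) by (cases m; cases "m - 1") (auto simp: q)
  define vs where "vs = take (Suc m) p"
  have len: "length vs = Suc m" using m by (simp add: vs_def)
  have nth: "vs ! i = p ! i" if "i \<le> m" for i using that by (simp add: vs_def)
  have "cycle_edge vs i \<in> E" if "i < length vs" for i
  proof (cases "i = m")
    case True
    then show ?thesis
      using m w e(1) by (simp add: cycle_edge_def len nth q insert_commute)
  next
    case False
    then have "i < m" using that len by simp
    then have "{p ! i, p ! Suc i} \<in> E"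
      using p m by (simp add: path_def successively_conv_nth)
    then show ?thesis
      using \<open>i < m\<close> by (simp add: cycle_edge_def len nth)
  qed
  then have "closed_path_edges vs \<subseteq> E"
    by (auto simp: closed_path_edges_eq)
  moreover have "distinct vs" using p by (simp add: path_def vs_def)
  ultimately show ?thesis using len m2 by (intro exI[of _ vs]) auto
qed

lemma cycle_trail:
  assumes "closed_path_edges vs \<subseteq> graph_edges UNIV" "i < length vs" "i \<le> j" "j \<le> length vs"
  shows "trail (vs ! i) (map (cycle_edge vs) [i..<j]) (vs ! (j mod length vs))"
  using assms(3,4)
proof (induction j rule: dec_induct)
  case base
  then show ?case using assms(2) by simp
next
  case (step j)
  then have j: "j < length vs" by simp
  then have "cycle_edge vs j \<in> graph_edges UNIV"
    using assms(1) by (auto simp: closed_path_edges_eq)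
  then have edge: "trail (vs ! j) [cycle_edge vs j] (vs ! (Suc j mod length vs))"
    by (simp add: cycle_edge_def)
  have "trail (vs ! i) (map (cycle_edge vs) [i..<j]) (vs ! j)"
    using step.IH j by simp
  from trail_append[OF this edge] show ?case
    using step.hyps(1) by simp
qed

lemma edges_doubleton: "e \<in> edges s \<Longrightarrow> \<exists>x y. x \<noteq> y \<and> e = {x, y}"
proof -
  assume "e \<in> edges s"
  then obtain u v where "e = {u, v}" "dist u v = 1"
    unfolding edges_def by blast
  then show ?thesis by (intro exI[of _ u] exI[of _ v]) auto
qed

lemma count_list_distinct: "distinct xs \<Longrightarrow> count_list xs x = (if x \<in> set xs then 1 else 0)"
  by (induction xs) auto

text \<open>
  The boundary contains some simple cycle. Neither \<open>F\<close> nor its complement crosses the boundary,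
  so each is contained in one of the two classes into which this cycle separates the tiles. The
  cycle has an edge between \<open>F\<close> and its complement, so these classes are \<open>F\<close> and the complement,
  and the cycle contains all edges between them. No local argument excludes that two tiles of
  \<open>F\<close> touch diagonally between two tiles of the complement, where the boundary would pass twice
  through a vertex; the global one does.
\<close>

lemma boundary_is_simple_cycle:
  assumes "finite F" "F \<noteq> {}" "plus_connected F" "plus_connected (- F)"
  shows "\<exists>vs. length vs \<ge> 3 \<and> distinct vs \<and> boundary_edges F = closed_path_edges vs"
proof -
  let ?E = "boundary_edges F"
  have "?E \<noteq> {}"
  proof
    assume empty: "?E = {}"
    have up: "(i, j + int n) \<in> F" if "(i, j) \<in> F" for i j n
    proof (induction n)
      case (Suc n)
      have "hor i (j + int (Suc n)) \<notin> ?E" using empty by simp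
      then show ?case using Suc by simp
    qed (use that in simp)
    obtain i j where ij: "(i, j) \<in> F" using assms(2) by auto
    have "range (\<lambda>n. (i, j + int n)) \<subseteq> F" using up[OF ij] by auto
    moreover have "infinite (range (\<lambda>n. (i, j + int n)))"
      by (rule range_inj_infinite) (auto intro: injI)
    ultimately show False using assms(1) finite_subset by blast
  qed
  moreover have "finite ?E"
    using finite_graph_edges[OF assms(1)] boundary_edges_subset finite_subset by blast
  moreover have "\<exists>x y. x \<noteq> y \<and> e = {x, y}" if "e \<in> ?E" for e
    using that edges_doubleton by (blast elim: boundary_edgesE)
  ultimately obtain vs where vs: "length vs \<ge> 3" "distinct vs" "closed_path_edges vs \<subseteq> ?E"
    using graph_contains_cycle[of ?E] boundary_edges_no_end by metis
  let ?n = "length vs"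
  let ?C = "closed_path_edges vs"
  let ?es = "map (cycle_edge vs) [0..<?n]"
  have lattice: "?C \<subseteq> graph_edges UNIV"
    using vs(3) boundary_edges_subset[of F] graph_edges_mono[of F UNIV] by blast
  have pos: "0 < ?n"
    using vs(1) by linarith
  have trail: "trail (vs ! 0) ?es (vs ! 0)"
    using cycle_trail[OF lattice pos le0 order_refl] by simp
  have "distinct ?es" "set ?es = ?C"
    using cycle_edge_inj[OF vs(2,1)]
    by (auto simp: distinct_map closed_path_edges_eq atLeast0LessThan)
  then have count: "even (count_list ?es e) \<longleftrightarrow> e \<notin> ?C" for e
    by (simp add: count_list_distinct)
  obtain I where "\<forall>s t e. e \<in> edges s \<longrightarrow> e \<in> edges t \<longrightarrow> s \<noteq> t \<longrightarrow>
    ((s \<in> I \<longleftrightarrow> t \<in> I) \<longleftrightarrow> even (count_list ?es e))"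
    using closed_trail_separates[OF trail] ..
  then have I: "(s \<in> I \<longleftrightarrow> t \<in> I) \<longleftrightarrow> e \<notin> ?C" if "e \<in> edges s" "e \<in> edges t" "s \<noteq> t" for s t e
    using that count by blast
  \<comment> \<open>Each of \<open>F\<close> and its complement lies on a single side of the cycle.\<close>
  have const: "s \<in> I \<longleftrightarrow> t \<in> I" if "plus_connected X" "X = F \<or> X = - F" "s \<in> X" "t \<in> X" for X s t
    using that(1)
  proof (rule plus_connected_invariant[where P = "\<lambda>r. s \<in> I \<longleftrightarrow> r \<in> I"])
    fix r r' assume r: "r \<in> X" "r' \<in> X" "plus_adjacent r r'" "s \<in> I \<longleftrightarrow> r \<in> I"
    then obtain e where e: "e \<in> edges r" "e \<in> edges r'" "r \<noteq> r'" by (auto elim: plus_adjacentE)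
    then have "e \<notin> ?E"
      using edge_on_two_squares[OF e] r(1,2) that(2) by (auto elim!: boundary_edgesE)
    then show "s \<in> I \<longleftrightarrow> r' \<in> I" using I[OF e] vs(3) r(4) by blast
  qed (use that in auto)
  from pos have "cycle_edge vs 0 \<in> ?C" by (simp add: closed_path_edges_eq)
  moreover from this obtain s t where st: "s \<in> F" "t \<notin> F" "cycle_edge vs 0 \<in> edges s" "cycle_edge vs 0 \<in> edges t"
    using vs(3) by (blast elim: boundary_edgesE)
  ultimately have sep: "s \<in> I \<longleftrightarrow> t \<notin> I" using I[of "cycle_edge vs 0" s t] by blast
  have "e \<in> ?C" if "e \<in> ?E" for e
    using that
  proof (rule boundary_edgesE)
    fix s' t' assume *: "s' \<in> F" "t' \<notin> F" "e \<in> edges s'" "e \<in> edges t'"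
    have "s' \<in> I \<longleftrightarrow> s \<in> I"
      by (rule const[OF assms(3)]) (use * st in simp_all)
    moreover have "t' \<in> I \<longleftrightarrow> t \<in> I"
      by (rule const[OF assms(4)]) (use * st in simp_all)
    moreover have "s' \<noteq> t'"
      using * by blast
    ultimately show ?thesis
      using sep I[OF *(3,4)] by argo
  qed
  then show ?thesis using vs by blast
qed

section \<open>Interior and exterior of lattice cycles\<close>

fun centre :: "square \<Rightarrow> complex" where
  "centre (i, j) = Complex (of_int i) (of_int j)"

lemma mem_open_square:
  "z \<in> open_square (i, j) \<longleftrightarrow> \<bar>Re z - of_int i\<bar> < 1/2 \<and> \<bar>Im z - of_int j\<bar> < 1/2"
  by (simp only: open_square.simps in_box_complex_iff complex.sel greaterThanLessThan_iff; safe; linarith)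

lemma horizontal_segment:
  "x \<le> x' \<Longrightarrow> z \<in> closed_segment (Complex x y) (Complex x' y) \<longleftrightarrow> x \<le> Re z \<and> Re z \<le> x' \<and> Im z = y"
  by (subst closed_segment_same_Im) (auto simp: closed_segment_eq_real_ivl)

lemma vertical_segment:
  "y \<le> y' \<Longrightarrow> z \<in> closed_segment (Complex x y) (Complex x y') \<longleftrightarrow> Re z = x \<and> y \<le> Im z \<and> Im z \<le> y'"
  by (subst closed_segment_same_Re) (auto simp: closed_segment_eq_real_ivl)

lemma convex_hull_hor:
  "z \<in> convex hull (hor a b) \<longleftrightarrow> \<bar>Re z - of_int a\<bar> \<le> 1/2 \<and> Im z = of_int b - 1/2"
proof -
  have "z \<in> convex hull (hor a b) \<longleftrightarrow>
      of_int a - 1/2 \<le> Re z \<and> Re z \<le> of_int (a + 1) - 1/2 \<and> Im z = of_int b - 1/2"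
    unfolding hor_def corner_def segment_convex_hull[symmetric]
    by (rule horizontal_segment) simp
  also have "\<dots> \<longleftrightarrow> \<bar>Re z - of_int a\<bar> \<le> 1/2 \<and> Im z = of_int b - 1/2"
    by (safe; linarith)
  finally show ?thesis .
qed

lemma convex_hull_ver:
  "z \<in> convex hull (ver a b) \<longleftrightarrow> Re z = of_int a - 1/2 \<and> \<bar>Im z - of_int b\<bar> \<le> 1/2"
proof -
  have "z \<in> convex hull (ver a b) \<longleftrightarrow>
      Re z = of_int a - 1/2 \<and> of_int b - 1/2 \<le> Im z \<and> Im z \<le> of_int (b + 1) - 1/2"
    unfolding ver_def corner_def segment_convex_hull[symmetric]
    by (rule vertical_segment) simp
  also have "\<dots> \<longleftrightarrow> Re z = of_int a - 1/2 \<and> \<bar>Im z - of_int b\<bar> \<le> 1/2"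
    by (safe; linarith)
  finally show ?thesis .
qed

lemma cycle_traceE:
  assumes "z \<in> cycle_trace C" "C \<subseteq> graph_edges UNIV"
  obtains a b where "hor a b \<in> C" "\<bar>Re z - of_int a\<bar> \<le> 1/2" "Im z = of_int b - 1/2"
  | a b where "ver a b \<in> C" "Re z = of_int a - 1/2" "\<bar>Im z - of_int b\<bar> \<le> 1/2"
proof -
  obtain e where e: "e \<in> C" "z \<in> convex hull e"
    using assms(1) unfolding cycle_trace_def by blast
  then obtain s where "e \<in> edges s"
    using assms(2) unfolding graph_edges_def by blast
  then show thesis
  proof (cases rule: edge_cases)
    case (1 a b)
    then show thesis using e that(1)[of a b] by (simp add: convex_hull_hor)
  next
    case (2 a b)
    then show thesis using e that(2)[of a b] by (simp add: convex_hull_ver)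
  qed
qed

text \<open>
  Lattice edges lie on lines with half integer coordinates, which no open tile meets.
\<close>

lemma half_integer_not_near_integer: "\<not> \<bar>of_int a - 1/2 - of_int b\<bar> < (1/2 :: real)"
proof
  assume "\<bar>of_int a - 1/2 - of_int b\<bar> < (1/2 :: real)"
  then have "of_int b < (of_int a :: real)" "of_int a < (of_int (b + 1) :: real)"
    by linarith+
  then have "b < a" "a < b + 1"
    by (simp_all only: of_int_less_iff)
  then show False by simp
qed

lemma open_square_avoids_trace:
  assumes "C \<subseteq> graph_edges UNIV"
  shows "open_square s \<subseteq> - cycle_trace C"
proof (rule subsetI, rule ComplI)
  fix z assume z: "z \<in> open_square s" "z \<in> cycle_trace C"
  obtain i j where s: "s = (i, j)" by (cases s)
  note m = z(1)[unfolded s mem_open_square]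
  from z(2) assms show False
    by (rule cycle_traceE) (use m half_integer_not_near_integer in \<open>metis\<close>)+
qed

lemma centre_in_open_square: "centre s \<in> open_square s"
  by (cases s) (simp add: mem_open_square del: open_square.simps)

lemma convex_open_square: "convex (open_square s)"
  by (cases s) (simp add: convex_box)

text \<open>
  Open tiles are connected and avoid every lattice cycle, so the centre decides on which side a
  tile lies.
\<close>

lemma component_open_square:
  assumes "C \<subseteq> graph_edges UNIV" "z \<in> open_square s"
  shows "connected_component_set (- cycle_trace C) z = connected_component_set (- cycle_trace C) (centre s)"
proof -
  have "connected_component (- cycle_trace C) z (centre s)"
    unfolding connected_component_def
    using assms open_square_avoids_trace[of C s] centre_in_open_square[of s]
      convex_connected[OF convex_open_square[of s]] by blast
  then show ?thesis
    by (metis connected_component_eq mem_Collect_eq)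
qed

lemma square_in_exterior_iff:
  assumes "C \<subseteq> graph_edges UNIV"
  shows "square_in_exterior C s \<longleftrightarrow>
    \<not> bounded (connected_component_set (- cycle_trace C) (centre s))"
proof
  assume "square_in_exterior C s"
  then show "\<not> bounded (connected_component_set (- cycle_trace C) (centre s))"
    using centre_in_open_square[of s] unfolding square_in_exterior_def outside by blast
next
  assume unb: "\<not> bounded (connected_component_set (- cycle_trace C) (centre s))"
  show "square_in_exterior C s"
    unfolding square_in_exterior_def outside
  proof (intro subsetI CollectI)
    fix z assume z: "z \<in> open_square s"
    show "\<not> bounded (connected_component_set (- cycle_trace C) z)"
      using unb by (simp only: component_open_square[OF assms z] not_False_eq_True)
  qed
qed

lemma square_in_interior_iff:
  assumes "C \<subseteq> graph_edges UNIV"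
  shows "square_in_interior C s \<longleftrightarrow>
    bounded (connected_component_set (- cycle_trace C) (centre s))"
proof
  assume "square_in_interior C s"
  then show "bounded (connected_component_set (- cycle_trace C) (centre s))"
    using centre_in_open_square[of s] unfolding square_in_interior_def inside_def by blast
next
  assume bd: "bounded (connected_component_set (- cycle_trace C) (centre s))"
  show "square_in_interior C s"
    unfolding square_in_interior_def inside_def
  proof (intro subsetI CollectI conjI)
    fix z assume z: "z \<in> open_square s"
    then show "z \<notin> cycle_trace C"
      using open_square_avoids_trace[OF assms, of s] by blast
    show "bounded (connected_component_set (- cycle_trace C) z)"
      using bd by (simp only: component_open_square[OF assms z])
  qed
qed

text \<open>
  The segment between the centres of two adjacent tiles has one integer coordinate, and the
  other one takes a single half integer value. This leaves the midpoint of the shared edge as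
  its only point on a lattice edge.
\<close>

lemma segment_crosses_only_shared_edge:
  assumes "C \<subseteq> graph_edges UNIV" "e \<notin> C" "e \<in> edges s" "e \<in> edges t" "s \<noteq> t"
  shows "closed_segment (centre s) (centre t) \<subseteq> - cycle_trace C"
proof (rule subsetI, rule ComplI)
  fix z assume z: "z \<in> closed_segment (centre s) (centre t)" "z \<in> cycle_trace C"
  have int: "a = b" if "\<bar>of_int a - (of_int b :: real)\<bar> \<le> 1/2" for a b :: int
    using that by linarith
  have int2: "a = b" if "(of_int b - 1 :: real) \<le> of_int a - 1/2" "(of_int a - 1/2 :: real) \<le> of_int b" for a b :: int
    using that by linarith
  have half: "(of_int a :: real) \<noteq> of_int b - 1/2" for a b :: int
  proof
    assume "(of_int a :: real) = of_int b - 1/2"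
    then have "(of_int (2 * a) :: real) = of_int (2 * b - 1)" by simp
    then have "2 * a = 2 * b - 1" by (simp only: of_int_eq_iff)
    then show False by presburger
  qed
  from assms(3) show False
  proof (cases rule: edge_cases)
    case (1 a b)
    then have "{s, t} = {(a, b), (a, b - 1)}"
      using assms by (auto simp: hor_in_edges_iff)
    then have "closed_segment (centre s) (centre t) = closed_segment (centre (a, b - 1)) (centre (a, b))"
      by (auto simp: doubleton_eq_iff closed_segment_commute)
    with z(1) have "z \<in> closed_segment (Complex (of_int a) (of_int b - 1)) (Complex (of_int a) (of_int b))"
      by simp
    then have m: "Re z = of_int a" "of_int b - 1 \<le> Im z" "Im z \<le> of_int b"
      by (simp_all add: vertical_segment)
    from z(2) assms(1) show False
    proof (rule cycle_traceE)
      fix a' b' assume *: "hor a' b' \<in> C" "\<bar>Re z - of_int a'\<bar> \<le> 1/2" "Im z = of_int b' - 1/2"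
      have "a = a'" "b' = b"
        using * m int[of a a'] int2[of b b'] by auto
      then show False using * 1 assms(2) by simp
    next
      fix a' b' assume "Re z = of_int a' - 1/2"
      then show False using m(1) half[of a a'] by simp
    qed
  next
    case (2 a b)
    then have "{s, t} = {(a, b), (a - 1, b)}"
      using assms by (auto simp: ver_in_edges_iff)
    then have "closed_segment (centre s) (centre t) = closed_segment (centre (a - 1, b)) (centre (a, b))"
      by (auto simp: doubleton_eq_iff closed_segment_commute)
    with z(1) have "z \<in> closed_segment (Complex (of_int a - 1) (of_int b)) (Complex (of_int a) (of_int b))"
      by simp
    then have m: "Im z = of_int b" "of_int a - 1 \<le> Re z" "Re z \<le> of_int a"
      by (simp_all add: horizontal_segment)
    from z(2) assms(1) show False
    proof (rule cycle_traceE)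
      fix a' b' assume *: "ver a' b' \<in> C" "Re z = of_int a' - 1/2" "\<bar>Im z - of_int b'\<bar> \<le> 1/2"
      have "b = b'" "a' = a"
        using * m int[of b b'] int2[of a a'] by auto
      then show False using * 2 assms(2) by simp
    next
      fix a' b' assume "Im z = of_int b' - 1/2"
      then show False using m(1) half[of b b'] by simp
    qed
  qed
qed

lemma component_across_edge:
  assumes "C \<subseteq> graph_edges UNIV" "e \<notin> C" "e \<in> edges s" "e \<in> edges t"
  shows "connected_component (- cycle_trace C) (centre s) (centre t)"
proof (cases "s = t")
  case True
  then show ?thesis
    using open_square_avoids_trace[OF assms(1), of s] centre_in_open_square[of s] by auto
next
  case False
  from segment_crosses_only_shared_edge[OF assms False] show ?thesis
    unfolding connected_component_def
    by (intro exI[of _ "closed_segment (centre s) (centre t)"]) auto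
qed

lemma exterior_across_edge:
  assumes "C \<subseteq> graph_edges UNIV" "e \<notin> C" "e \<in> edges s" "e \<in> edges t" "square_in_exterior C s"
  shows "square_in_exterior C t"
  using component_across_edge[OF assms(1-4)] assms(5)
  unfolding square_in_exterior_iff[OF assms(1)]
  by (metis connected_component_eq mem_Collect_eq)

text \<open>
  All centres of the region lie in one component of the complement of the cycle, and infinitely
  many tiles are not contained in a bounded set.
\<close>

lemma infinite_region_in_exterior:
  assumes "C \<subseteq> graph_edges UNIV" "plus_connected X" "infinite X"
    and "\<And>s t e. s \<in> X \<Longrightarrow> t \<in> X \<Longrightarrow> s \<noteq> t \<Longrightarrow> e \<in> edges s \<Longrightarrow> e \<in> edges t \<Longrightarrow> e \<notin> C"
    and "s \<in> X"
  shows "square_in_exterior C s"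
  unfolding square_in_exterior_iff[OF assms(1)]
proof
  let ?K = "connected_component_set (- cycle_trace C) (centre s)"
  assume "bounded ?K"
  then obtain B where B: "\<And>z. z \<in> ?K \<Longrightarrow> norm z \<le> B"
    unfolding bounded_iff by blast
  have "centre t \<in> ?K" if "t \<in> X" for t
    using assms(2)
  proof (rule plus_connected_invariant[where s = s and P = "\<lambda>t. centre t \<in> ?K"])
    fix r t assume r: "r \<in> X" "t \<in> X" "plus_adjacent r t" "centre r \<in> ?K"
    then obtain e where "e \<in> edges r" "e \<in> edges t" "r \<noteq> t" by (auto elim: plus_adjacentE)
    then have "connected_component (- cycle_trace C) (centre r) (centre t)"
      using component_across_edge[OF assms(1)] assms(4) r by blast
    then show "centre t \<in> ?K"
      using r(4) connected_component_trans by auto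
  qed (use that assms(5) open_square_avoids_trace[OF assms(1), of s] centre_in_open_square[of s] in auto)
  then have norm: "norm (centre t) \<le> B" if "t \<in> X" for t
    using B that by blast
  have "X \<subseteq> {- \<lceil>B\<rceil>..\<lceil>B\<rceil>} \<times> {- \<lceil>B\<rceil>..\<lceil>B\<rceil>}"
  proof
    fix t assume "t \<in> X"
    obtain i j where t: "t = (i, j)" by (cases t)
    have "\<bar>of_int i\<bar> \<le> B" "\<bar>of_int j\<bar> \<le> B"
      using norm[OF \<open>t \<in> X\<close>] abs_Re_le_cmod[of "centre t"] abs_Im_le_cmod[of "centre t"]
      by (auto simp: t)
    then show "t \<in> {- \<lceil>B\<rceil>..\<lceil>B\<rceil>} \<times> {- \<lceil>B\<rceil>..\<lceil>B\<rceil>}"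
      unfolding t by (auto; linarith)
  qed
  then have "finite X" by (rule finite_subset) simp
  then show False using assms(3) by simp
qed

fun closed_square :: "square \<Rightarrow> complex set" where
  "closed_square (i, j) =
     cbox (Complex (of_int i - 1/2) (of_int j - 1/2)) (Complex (of_int i + 1/2) (of_int j + 1/2))"

lemma mem_closed_square:
  "z \<in> closed_square (i, j) \<longleftrightarrow> \<bar>Re z - of_int i\<bar> \<le> 1/2 \<and> \<bar>Im z - of_int j\<bar> \<le> 1/2"
  by (simp only: closed_square.simps in_cbox_complex_iff complex.sel atLeastAtMost_iff; safe; linarith)

lemma closed_closed_square: "closed (closed_square s)"
  by (cases s) (simp add: closed_cbox)

lemma bounded_closed_square: "bounded (closed_square s)"
  by (cases s) (simp add: bounded_cbox)

lemma in_some_closed_square: "\<exists>s. z \<in> closed_square s"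
  by (rule exI[of _ "(round (Re z), round (Im z))"])
     (use of_int_round_abs_le[of "Re z"] of_int_round_abs_le[of "Im z"] in
       \<open>simp add: mem_closed_square abs_minus_commute del: closed_square.simps\<close>)

text \<open>
  If the two tiles touch only diagonally, a third tile, in the row of one and the column of the
  other, contains the common point too; it differs from one of the two in its membership in \<open>F\<close>.
  This reduces the claim to tiles in a common row or column.
\<close>

lemma shared_point_on_boundary:
  assumes "z \<in> closed_square s" "s \<in> F" "z \<in> closed_square t" "t \<notin> F"
  shows "z \<in> cycle_trace (boundary_edges F)"
proof -
  have trace: "z \<in> cycle_trace (boundary_edges F)" if "e \<in> boundary_edges F" "z \<in> convex hull e" for e
    using that unfolding cycle_trace_def by blast
  have vert: "z \<in> cycle_trace (boundary_edges F)"
    if h: "z \<in> closed_square (i, j)" "z \<in> closed_square (i, j')" "(i, j) \<in> F \<longleftrightarrow> (i, j') \<notin> F" for i j j'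
  proof -
    have m: "\<bar>Re z - of_int i\<bar> \<le> 1/2" "\<bar>Im z - of_int j\<bar> \<le> 1/2" "\<bar>Im z - of_int j'\<bar> \<le> 1/2"
      using h unfolding mem_closed_square by auto
    then have "j' = j \<or> j' = j - 1 \<or> j' = j + 1" by linarith
    then consider "j' = j - 1" | "j' = j + 1" using h(3) by blast
    then show ?thesis
    proof cases
      case 1
      have "Im z = of_int j - 1/2" using m 1 by (simp add: abs_le_iff)
      moreover have "hor i j \<in> boundary_edges F"
        using h(3) unfolding boundary_edges_hor 1 .
      ultimately show ?thesis using m(1) by (intro trace[of "hor i j"]) (simp_all add: convex_hull_hor)
    next
      case 2
      have "Im z = of_int j' - 1/2" using m 2 by (simp add: abs_le_iff)
      moreover have "hor i j' \<in> boundary_edges F"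
        using h(3) unfolding boundary_edges_hor 2 add_diff_cancel_right' by argo
      ultimately show ?thesis using m(1) by (intro trace[of "hor i j'"]) (simp_all add: convex_hull_hor)
    qed
  qed
  have horiz: "z \<in> cycle_trace (boundary_edges F)"
    if h: "z \<in> closed_square (i, j)" "z \<in> closed_square (i', j)" "(i, j) \<in> F \<longleftrightarrow> (i', j) \<notin> F" for i i' j
  proof -
    have m: "\<bar>Im z - of_int j\<bar> \<le> 1/2" "\<bar>Re z - of_int i\<bar> \<le> 1/2" "\<bar>Re z - of_int i'\<bar> \<le> 1/2"
      using h unfolding mem_closed_square by auto
    then have "i' = i \<or> i' = i - 1 \<or> i' = i + 1" by linarith
    then consider "i' = i - 1" | "i' = i + 1" using h(3) by blast
    then show ?thesis
    proof cases
      case 1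
      have "Re z = of_int i - 1/2" using m 1 by (simp add: abs_le_iff)
      moreover have "ver i j \<in> boundary_edges F"
        using h(3) unfolding boundary_edges_ver 1 .
      ultimately show ?thesis using m(1) by (intro trace[of "ver i j"]) (simp_all add: convex_hull_ver)
    next
      case 2
      have "Re z = of_int i' - 1/2" using m 2 by (simp add: abs_le_iff)
      moreover have "ver i' j \<in> boundary_edges F"
        using h(3) unfolding boundary_edges_ver 2 add_diff_cancel_right' by argo
      ultimately show ?thesis using m(1) by (intro trace[of "ver i' j"]) (simp_all add: convex_hull_ver)
    qed
  qed
  obtain i j k l where st: "s = (i, j)" "t = (k, l)" by (cases s, cases t)
  have "z \<in> closed_square (i, l)"
    using assms unfolding st mem_closed_square by blast
  then show ?thesis
    using vert[of i j l] horiz[of i l k] assms unfolding st by blast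
qed

text \<open>
  Let \<open>X\<close> be the closed region covered by \<open>F\<close>. The frontier of \<open>X\<close> is contained in the trace of
  the boundary edges, so a connected set that avoids this trace and meets \<open>X\<close> stays inside the
  bounded set \<open>X\<close>.
\<close>

lemma boundary_encloses:
  assumes "finite F" "s \<in> F"
  shows "square_in_interior (boundary_edges F) s"
proof -
  let ?S = "cycle_trace (boundary_edges F)"
  let ?K = "connected_component_set (- ?S) (centre s)"
  define X where "X = (\<Union>t\<in>F. closed_square t)"
  have sub: "boundary_edges F \<subseteq> graph_edges UNIV"
    using boundary_edges_subset graph_edges_mono by blast
  have "closed X"
    unfolding X_def using assms(1) closed_closed_square by (intro closed_UN) auto
  have "bounded X"
    unfolding X_def using assms(1) bounded_closed_square by (intro bounded_UN) auto
  have "frontier X \<subseteq> ?S"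
  proof
    fix z assume z: "z \<in> frontier X"
    then have "z \<in> X" using \<open>closed X\<close> by (simp add: frontier_def)
    then obtain r where r: "r \<in> F" "z \<in> closed_square r" by (auto simp: X_def)
    obtain i j where ij: "r = (i, j)" by (cases r)
    \<comment> \<open>\<open>N\<close> contains the tiles off \<open>F\<close> that come close to \<open>z\<close>; being finite, it has a closed union,
      which can be cut out of a ball around \<open>z\<close>.\<close>
    define N where "N = {i-2..i+2} \<times> {j-2..j+2} - F"
    show "z \<in> ?S"
    proof (rule ccontr)
      assume "z \<notin> ?S"
      then have notin: "z \<notin> closed_square t" if "t \<notin> F" for t
        using shared_point_on_boundary r that by blast
      define U where "U = ball z 1 - (\<Union>t\<in>N. closed_square t)"
      have "closed (\<Union>t\<in>N. closed_square t)"
        using closed_closed_square by (intro closed_UN) (auto simp: N_def)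
      then have "open U" unfolding U_def by (intro open_Diff) auto
      moreover have "z \<in> U" using notin by (auto simp: U_def N_def)
      moreover have "U \<subseteq> X"
      proof
        fix w assume w: "w \<in> U"
        obtain k l where kl: "w \<in> closed_square (k, l)"
          using in_some_closed_square[of w] by auto
        have "\<bar>Re (w - z)\<bar> < 1" "\<bar>Im (w - z)\<bar> < 1"
          using w abs_Re_le_cmod[of "w - z"] abs_Im_le_cmod[of "w - z"]
          by (auto simp: U_def dist_norm norm_minus_commute)
        then have "\<bar>of_int k - of_int i\<bar> < (3::real)" "\<bar>of_int l - of_int j\<bar> < (3::real)"
          using kl r(2) unfolding ij mem_closed_square minus_complex.sel by linarith+
        then have "(k, l) \<in> {i-2..i+2} \<times> {j-2..j+2}"
          by (auto; linarith)
        then have "(k, l) \<in> F"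
          using w kl unfolding U_def N_def by blast
        then show "w \<in> X" using kl unfolding X_def by blast
      qed
      ultimately have "z \<in> interior X" by (rule interiorI)
      then show False using z by (simp add: frontier_def)
    qed
  qed
  then have "?K \<inter> frontier X = {}"
    using connected_component_subset[of "- ?S" "centre s"] by blast
  moreover have c: "centre s \<in> ?K"
    using open_square_avoids_trace[OF sub, of s] centre_in_open_square[of s] by auto
  moreover have "centre s \<in> X"
    unfolding X_def using assms(2) by (cases s) (force simp: mem_closed_square simp del: closed_square.simps)
  ultimately have "?K \<subseteq> X"
    using connected_Int_frontier[of ?K X] connected_connected_component by blast
  then have "bounded ?K" using \<open>bounded X\<close> bounded_subset by blast
  then show ?thesis using square_in_interior_iff[OF sub] by blast
qed

lemma not_interior_and_exterior: "square_in_interior C s \<Longrightarrow> \<not> square_in_exterior C s"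
  unfolding square_in_interior_def square_in_exterior_def
  using centre_in_open_square[of s] inside_Int_outside by blast

section \<open>The outermost boundary\<close>

lemma is_cycle_subset: "is_cycle A C \<Longrightarrow> C \<subseteq> graph_edges A"
  unfolding is_cycle_def by blast

text \<open>
  An edge of \<open>C\<close> is a side of a tile of \<open>F\<close>, so the infinite connected complement of \<open>F\<close> never
  crosses \<open>C\<close> and lies in its exterior. A boundary edge not on \<open>C\<close> joins a tile of the
  complement to one in \<open>F\<close>, and the latter is in the exterior as well.
\<close>

lemma boundary_edge_outermost:
  assumes "finite F" "plus_connected (- F)" "C \<subseteq> graph_edges F" "e \<in> boundary_edges F" "e \<notin> C"
  shows "edge_in_exterior C e"
proof -
  have lattice: "C \<subseteq> graph_edges UNIV"
    using assms(3) graph_edges_mono[of F UNIV] by blast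
  have inf: "infinite (- F)"
    using assms(1) by (simp add: Compl_eq_Diff_UNIV Diff_infinite_finite infinite_UNIV_char_0 finite_prod)
  have out: "square_in_exterior C s" if "s \<in> - F" for s
    using lattice assms(2) inf
  proof (rule infinite_region_in_exterior[OF _ _ _ _ that])
    fix s t e assume st: "s \<in> - F" "t \<in> - F" "s \<noteq> t" "e \<in> edges s" "e \<in> edges t"
    then show "e \<notin> C"
      using assms(3) edge_on_two_squares[OF st(4,5,3)] unfolding graph_edges_def by blast
  qed
  obtain t where t: "t \<notin> F" "e \<in> edges t"
    using assms(4) by (rule boundary_edgesE)
  show ?thesis
    unfolding edge_in_exterior_def
    using exterior_across_edge[OF lattice assms(5) t(2)] out t(1) by blast
qed

text \<open>
  An edge of \<open>W\<close> off the boundary of \<open>F\<close> is not in its exterior, because it is a side of a tile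
  of \<open>F\<close>, and \<open>F\<close> lies in the interior. The edges of the boundary are outermost by the previous
  lemma.
\<close>

lemma outermost_boundary_eq:
  assumes "finite F" "plus_connected (- F)" "W \<subseteq> F" "is_cycle W (boundary_edges F)"
  shows "outermost_boundary W = boundary_edges F"
proof (intro set_eqI iffI)
  fix e assume "e \<in> outermost_boundary W"
  then have e: "e \<in> graph_edges W" "e \<in> boundary_edges F \<or> edge_in_exterior (boundary_edges F) e"
    using assms(4) unfolding outermost_boundary_def by blast+
  then obtain s where "s \<in> W" "e \<in> edges s"
    unfolding graph_edges_def by blast
  then show "e \<in> boundary_edges F"
    using e(2) boundary_encloses[OF assms(1)] not_interior_and_exterior assms(3)
    unfolding edge_in_exterior_def by blast
next
  fix e assume e: "e \<in> boundary_edges F"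
  have "e \<in> C \<or> edge_in_exterior C e" if "is_cycle W C" for C
    using boundary_edge_outermost[OF assms(1,2) _ e] is_cycle_subset[OF that] graph_edges_mono[OF assms(3)]
    by blast
  then show "e \<in> outermost_boundary W"
    using e is_cycle_subset[OF assms(4)] unfolding outermost_boundary_def by blast
qed

text \<open>
  A boundary edge of \<open>F\<close> either is on the outermost boundary of \<open>W\<close> or is in its exterior; the
  latter is impossible, because the tile of \<open>F\<close> at this edge is enclosed. So the boundary of \<open>F\<close>
  is a cycle made of edges of \<open>W\<close>, and the previous lemma applies.
\<close>

lemma outermost_boundary_determined:
  assumes "finite F" "plus_connected (- F)" "W \<subseteq> F"
    and cycle: "is_cycle W (outermost_boundary W)"
    and F_cycle: "\<exists>vs. length vs \<ge> 3 \<and> distinct vs \<and> boundary_edges F = closed_path_edges vs"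
    and enclosed: "\<And>s t. s \<in> F \<Longrightarrow> t \<notin> F \<Longrightarrow> plus_adjacent s t \<Longrightarrow> square_in_interior (outermost_boundary W) s"
  shows "outermost_boundary W = boundary_edges F"
proof -
  have sub: "outermost_boundary W \<subseteq> graph_edges F"
    using is_cycle_subset[OF cycle] graph_edges_mono[OF assms(3)] by blast
  have "boundary_edges F \<subseteq> outermost_boundary W"
  proof
    fix e assume e: "e \<in> boundary_edges F"
    then obtain s t where st: "s \<in> F" "t \<notin> F" "e \<in> edges s" "e \<in> edges t"
      by (rule boundary_edgesE)
    then have "plus_adjacent s t"
      by (intro plus_adjacentI) auto
    then have "\<not> edge_in_exterior (outermost_boundary W) e"
      using enclosed[OF st(1,2)] not_interior_and_exterior st(3) unfolding edge_in_exterior_def by blast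
    then show "e \<in> outermost_boundary W"
      using boundary_edge_outermost[OF assms(1,2) sub e] by blast
  qed
  then have "is_cycle W (boundary_edges F)"
    using F_cycle is_cycle_subset[OF cycle] unfolding is_cycle_def by blast
  then show ?thesis
    by (rule outermost_boundary_eq[OF assms(1-3)])
qed

section \<open>Filling the holes of a region\<close>

lemma sym_plus_steps: "sym ((plus_steps X)\<^sup>*)"
  by (intro sym_rtrancl) (auto simp: sym_def plus_steps_def plus_adjacent_sym)

lemma plus_steps_rtrancl_mono: "X \<subseteq> Y \<Longrightarrow> (plus_steps X)\<^sup>* \<subseteq> (plus_steps Y)\<^sup>*"
  by (intro rtrancl_mono) (auto simp: plus_steps_def)

lemma plus_connected_reachable: "plus_connected {s. (z, s) \<in> (plus_steps X)\<^sup>*}"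
proof -
  let ?R = "{s. (z, s) \<in> (plus_steps X)\<^sup>*}"
  have from_z: "(z, s) \<in> (plus_steps ?R)\<^sup>*" if "(z, s) \<in> (plus_steps X)\<^sup>*" for s
    using that
  proof (induction rule: rtrancl_induct)
    case (step r s)
    have "s \<in> ?R" "r \<in> ?R"
      using step.hyps by (auto intro: rtrancl_into_rtrancl)
    then have "(r, s) \<in> plus_steps ?R"
      using step.hyps(2) unfolding plus_steps_def by blast
    with step.IH show ?case by (rule rtrancl_into_rtrancl)
  qed simp
  show ?thesis
    unfolding plus_connected_def
    using from_z symD[OF sym_plus_steps] rtrancl_trans by (metis (lifting) mem_Collect_eq)
qed

lemma plus_connected_extend:
  assumes "plus_connected A" "A \<subseteq> F"
    and reach: "\<And>s. s \<in> F \<Longrightarrow> \<exists>a\<in>A. (s, a) \<in> (plus_steps F)\<^sup>*"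
  shows "plus_connected F"
  unfolding plus_connected_def
proof (intro ballI)
  fix s t assume "s \<in> F" "t \<in> F"
  then obtain a b where ab: "a \<in> A" "b \<in> A" "(s, a) \<in> (plus_steps F)\<^sup>*" "(t, b) \<in> (plus_steps F)\<^sup>*"
    using reach by meson
  have "(a, b) \<in> (plus_steps F)\<^sup>*"
    using assms(1) ab(1,2) plus_steps_rtrancl_mono[OF assms(2)]
    unfolding plus_connected_def by blast
  with ab(3) have "(s, b) \<in> (plus_steps F)\<^sup>*" by (rule rtrancl_trans)
  then show "(s, t) \<in> (plus_steps F)\<^sup>*"
    using symD[OF sym_plus_steps ab(4)] by (rule rtrancl_trans)
qed

lemma vertical_steps:
  assumes "\<And>k. (i, k) \<in> X"
  shows "((i, j), (i, j')) \<in> (plus_steps X)\<^sup>*"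
proof -
  have up: "((i, j), (i, j')) \<in> (plus_steps X)\<^sup>*" if "j \<le> j'" for j j'
    using that
  proof (induction j' rule: int_ge_induct)
    case (step k)
    have "((i, k), (i, k + 1)) \<in> plus_steps X"
      using assms by (simp add: plus_steps_def plus_adjacent_iff)
    with step.IH show ?case by (rule rtrancl_into_rtrancl)
  qed simp
  show ?thesis
    using up[of j j'] symD[OF sym_plus_steps up[of j' j]] by (cases "j \<le> j'") simp_all
qed

lemma horizontal_steps:
  assumes "\<And>k. (k, j) \<in> X"
  shows "((i, j), (i', j)) \<in> (plus_steps X)\<^sup>*"
proof -
  have up: "((i, j), (i', j)) \<in> (plus_steps X)\<^sup>*" if "i \<le> i'" for i i'
    using that
  proof (induction i' rule: int_ge_induct)
    case (step k)
    have "((k, j), (k + 1, j)) \<in> plus_steps X"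
      using assms by (simp add: plus_steps_def plus_adjacent_iff)
    with step.IH show ?case by (rule rtrancl_into_rtrancl)
  qed simp
  show ?thesis
    using up[of i i'] symD[OF sym_plus_steps up[of i' i]] by (cases "i \<le> i'") simp_all
qed

lemma finite_square_set_bound:
  assumes "finite (A :: square set)"
  obtains N where "\<And>i j. (i, j) \<in> A \<Longrightarrow> \<bar>i\<bar> < N \<and> \<bar>j\<bar> < N"
proof -
  \<comment> \<open>Any bound works; this sum avoids a case distinction for the empty set.\<close>
  define N where "N = 1 + (\<Sum>(i, j)\<in>A. \<bar>i\<bar> + \<bar>j\<bar>)"
  show thesis
  proof (rule that[of N])
    fix i j assume "(i, j) \<in> A"
    then have "(case (i, j) of (i, j) \<Rightarrow> \<bar>i\<bar> + \<bar>j\<bar>) \<le> (\<Sum>(i, j)\<in>A. \<bar>i\<bar> + \<bar>j\<bar>)"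
      using assms by (intro member_le_sum) auto
    then show "\<bar>i\<bar> < N \<and> \<bar>j\<bar> < N"
      unfolding N_def prod.case by linarith
  qed
qed

text \<open>
  \<open>F\<close> is the complement of the component \<open>Out\<close> of a far away tile in the complement of \<open>A\<close>. To
  see that \<open>F\<close> is connected, walk upwards from a tile of \<open>F\<close>: a step from \<open>F - A\<close> never enters
  \<open>Out\<close>, and all tiles far up belong to \<open>Out\<close>, so the walk hits \<open>A\<close>.
\<close>

lemma hole_filling:
  assumes "finite A" "plus_connected A"
  shows "\<exists>F. finite F \<and> A \<subseteq> F \<and> plus_connected F \<and> plus_connected (- F) \<and>
    (\<forall>s\<in>F. \<forall>t. t \<notin> F \<longrightarrow> plus_adjacent s t \<longrightarrow> s \<in> A)"
proof -
  obtain N where N: "\<And>i j. (i, j) \<in> A \<Longrightarrow> \<bar>i\<bar> < N \<and> \<bar>j\<bar> < N"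
    using finite_square_set_bound[OF assms(1)] by blast
  define Out where "Out = {s. ((N, N), s) \<in> (plus_steps (- A))\<^sup>*}"
  have col: "(i, k) \<in> - A" if "N \<le> \<bar>i\<bar>" for i k
    using N[of i k] that by auto
  have row: "(k, j) \<in> - A" if "N \<le> \<bar>j\<bar>" for j k
    using N[of k j] that by auto
  have far: "(i, j) \<in> Out" if "N \<le> \<bar>i\<bar> \<or> N \<le> \<bar>j\<bar>" for i j
    using that
  proof
    assume i: "N \<le> \<bar>i\<bar>"
    have "((N, N), (i, N)) \<in> (plus_steps (- A))\<^sup>*"
      by (rule horizontal_steps[OF row]) simp
    also have "((i, N), (i, j)) \<in> (plus_steps (- A))\<^sup>*"
      by (rule vertical_steps[OF col[OF i]])
    finally show ?thesis unfolding Out_def by simp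
  next
    assume j: "N \<le> \<bar>j\<bar>"
    have "((N, N), (N, j)) \<in> (plus_steps (- A))\<^sup>*"
      by (rule vertical_steps[OF col]) simp
    also have "((N, j), (i, j)) \<in> (plus_steps (- A))\<^sup>*"
      by (rule horizontal_steps[OF row[OF j]])
    finally show ?thesis unfolding Out_def by simp
  qed
  have "(N, N) \<notin> A" using row[of N N] by simp
  then have Out_A: "s \<notin> A" if "s \<in> Out" for s
    using that unfolding Out_def by (auto elim: rtranclE simp: plus_steps_def)
  have Out_step: "t \<in> Out" if "s \<in> Out" "t \<notin> A" "plus_adjacent s t" for s t
  proof -
    have "(s, t) \<in> plus_steps (- A)"
      using that Out_A unfolding plus_steps_def by blast
    moreover have "((N, N), s) \<in> (plus_steps (- A))\<^sup>*"
      using that(1) unfolding Out_def by simp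
    ultimately have "((N, N), t) \<in> (plus_steps (- A))\<^sup>*"
      by (rule rtrancl_into_rtrancl[rotated])
    then show ?thesis unfolding Out_def by simp
  qed
  define F where "F = - Out"
  have "F \<subseteq> {-N..N} \<times> {-N..N}"
  proof
    fix s assume "s \<in> F"
    obtain i j where "s = (i, j)" by (cases s)
    have "\<not> (N \<le> \<bar>i\<bar> \<or> N \<le> \<bar>j\<bar>)"
      using \<open>s \<in> F\<close> \<open>s = (i, j)\<close> far[of i j] unfolding F_def by blast
    with \<open>s = (i, j)\<close> show "s \<in> {-N..N} \<times> {-N..N}"
      by auto
  qed
  then have "finite F" by (rule finite_subset) simp
  moreover have AF: "A \<subseteq> F" using Out_A by (auto simp: F_def)
  moreover have "plus_connected (- F)"
    using plus_connected_reachable[of "(N, N)" "- A"] by (simp add: F_def Out_def)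
  moreover have "s \<in> A" if "s \<in> F" "t \<notin> F" "plus_adjacent s t" for s t
    using that Out_step[of t s] plus_adjacent_sym[of s t] by (auto simp: F_def)
  moreover have "plus_connected F"
  proof -
    have reach: "\<exists>a\<in>A. (s, a) \<in> (plus_steps F)\<^sup>*" if "s \<in> F" for s
      using that
    proof (induction "nat (N - snd s)" arbitrary: s rule: less_induct)
      case less
      obtain i j where s: "s = (i, j)" by (cases s)
      show ?case
      proof (cases "s \<in> A")
        case False
        let ?t = "(i, j + 1)"
        have adj: "plus_adjacent s ?t" by (simp add: s plus_adjacent_iff)
        have "?t \<in> F"
          using Out_step[of ?t s] False adj less.prems plus_adjacent_sym[of s ?t] by (auto simp: F_def)
        moreover have "j < N"
        proof (rule ccontr)
          assume "\<not> j < N"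
          then have "N \<le> \<bar>i\<bar> \<or> N \<le> \<bar>j\<bar>" by linarith
          from far[OF this] show False using less.prems by (simp add: F_def s)
        qed
        ultimately obtain a where "a \<in> A" "(?t, a) \<in> (plus_steps F)\<^sup>*"
          using less.hyps[of ?t] by (auto simp: s)
        moreover have "(s, ?t) \<in> plus_steps F"
          using \<open>?t \<in> F\<close> less.prems adj by (simp add: plus_steps_def)
        ultimately show ?thesis by (meson converse_rtrancl_into_rtrancl)
      qed blast
    qed
    then show ?thesis
      by (rule plus_connected_extend[OF assms(2) AF])
  qed
  ultimately show ?thesis by (intro exI[of _ F]) blast
qed

section \<open>The occupied component and its vacant boundary\<close>

lemma plus_path_reaches:
  assumes "successively plus_adjacent p" "set p \<subseteq> X" "p \<noteq> []"
  shows "(hd p, last p) \<in> (plus_steps X)\<^sup>*"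
  using assms
proof (induction p)
  case (Cons s p)
  show ?case
  proof (cases "p = []")
    case False
    then have "(s, hd p) \<in> plus_steps X"
      using Cons.prems by (auto simp: successively_Cons plus_steps_def)
    moreover have "(hd p, last p) \<in> (plus_steps X)\<^sup>*"
      using Cons False by (auto simp: successively_Cons)
    ultimately show ?thesis using False by (auto intro: converse_rtrancl_into_rtrancl)
  qed simp
qed simp

text \<open>
  Passes from paths without repetition to the reflexive transitive closure: a path that returns
  to one of its tiles is cut off at that tile.
\<close>

lemma plus_component_eq_reachable:
  assumes "(0, 0) \<in> occ"
  shows "plus_component occ = {s. ((0, 0), s) \<in> (plus_steps occ)\<^sup>*}"
proof (intro set_eqI iffI)
  fix s assume "s \<in> plus_component occ"
  then obtain p where p: "occupied_plus_path occ p" "hd p = (0, 0)" "last p = s"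
    unfolding plus_component_def by blast
  then have "(hd p, last p) \<in> (plus_steps occ)\<^sup>*"
    by (intro plus_path_reaches) (simp_all add: occupied_plus_path_def)
  then show "s \<in> {s. ((0, 0), s) \<in> (plus_steps occ)\<^sup>*}"
    using p by simp
next
  fix s assume "s \<in> {s. ((0, 0), s) \<in> (plus_steps occ)\<^sup>*}"
  then have "((0, 0), s) \<in> (plus_steps occ)\<^sup>*" by simp
  then show "s \<in> plus_component occ"
  proof (induction rule: rtrancl_induct)
    case base
    have "occupied_plus_path occ [(0, 0)]"
      using assms by (simp add: occupied_plus_path_def)
    then show ?case
      unfolding plus_component_def by (intro CollectI exI[of _ "[(0, 0)]"]) simp
  next
    case (step r s)
    then obtain p where p: "occupied_plus_path occ p" "hd p = (0, 0)" "last p = r"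
      unfolding plus_component_def by blast
    have rs: "s \<in> occ" "plus_adjacent r s"
      using step.hyps(2) by (auto simp: plus_steps_def)
    have "\<exists>q. occupied_plus_path occ q \<and> hd q = (0, 0) \<and> last q = s"
    proof (cases "s \<in> set p")
      case True
      then obtain xs ys where "p = xs @ s # ys" by (auto dest: split_list)
      then show ?thesis
        using p by (intro exI[of _ "xs @ [s]"])
          (auto simp: occupied_plus_path_def successively_append_iff hd_append split: if_splits)
    next
      case False
      then show ?thesis
        using p rs by (intro exI[of _ "p @ [s]"])
          (auto simp: occupied_plus_path_def successively_append_iff)
    qed
    then show ?case unfolding plus_component_def by blast
  qed
qed

lemma plus_component_facts:
  assumes "(0, 0) \<in> occ"
  shows "(0, 0) \<in> plus_component occ" "plus_component occ \<subseteq> occ" "plus_connected (plus_component occ)"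
    and "\<And>s t. s \<in> plus_component occ \<Longrightarrow> plus_adjacent s t \<Longrightarrow> t \<in> plus_component occ \<union> vacant_boundary occ"
proof -
  note reach = plus_component_eq_reachable[OF assms]
  show "(0, 0) \<in> plus_component occ" "plus_connected (plus_component occ)"
    by (simp_all add: reach plus_connected_reachable)
  show sub: "plus_component occ \<subseteq> occ"
    unfolding plus_component_def occupied_plus_path_def using last_in_set by blast
  fix s t assume st: "s \<in> plus_component occ" "plus_adjacent s t"
  show "t \<in> plus_component occ \<union> vacant_boundary occ"
  proof (cases "t \<in> occ")
    case True
    then have "(s, t) \<in> plus_steps occ"
      using st sub unfolding plus_steps_def by blast
    moreover have "((0, 0), s) \<in> (plus_steps occ)\<^sup>*"
      using st(1) by (simp add: reach)
    ultimately have "((0, 0), t) \<in> (plus_steps occ)\<^sup>*"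
      by (rule rtrancl_into_rtrancl[rotated])
    then show ?thesis by (simp add: reach)
  next
    case False
    then show ?thesis
      using st plus_adjacent_sym[of s t] unfolding vacant_boundary_def by blast
  qed
qed

lemma finite_vacant_boundary:
  assumes "finite (plus_component occ)"
  shows "finite (vacant_boundary occ)"
proof (rule finite_subset)
  show "vacant_boundary occ \<subseteq> (\<Union>(i, j)\<in>plus_component occ. {i-1..i+1} \<times> {j-1..j+1})"
  proof
    fix t assume "t \<in> vacant_boundary occ"
    then obtain s where s: "s \<in> plus_component occ" "plus_adjacent t s"
      unfolding vacant_boundary_def by blast
    obtain i j k l where ij: "s = (i, j)" "t = (k, l)" by (cases s, cases t)
    have "\<bar>k - i\<bar> + \<bar>l - j\<bar> = 1"
      using s(2) unfolding ij plus_adjacent_iff .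
    then have "t \<in> {i-1..i+1} \<times> {j-1..j+1}"
      unfolding ij by auto
    then show "t \<in> (\<Union>(i, j)\<in>plus_component occ. {i-1..i+1} \<times> {j-1..j+1})"
      using s(1) unfolding ij by blast
  qed
qed (use assms in auto)

text \<open>
  A tile of the component itself cannot have a neighbour outside the filling, since all its
  neighbours are in the component or in the vacant boundary.
\<close>

lemma cluster_filling:
  assumes "(0, 0) \<in> occ" "finite (plus_component occ)"
  shows "\<exists>F. finite F \<and> plus_connected F \<and> plus_connected (- F) \<and>
    plus_component occ \<union> vacant_boundary occ \<subseteq> F \<and>
    (\<forall>s\<in>F. \<forall>t. t \<notin> F \<longrightarrow> plus_adjacent s t \<longrightarrow> s \<in> vacant_boundary occ)"
proof -
  let ?C = "plus_component occ" and ?L = "vacant_boundary occ"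
  note C = plus_component_facts[OF assms(1)]
  have "plus_connected (?C \<union> ?L)"
    using C(3)
  proof (rule plus_connected_extend)
    fix s assume "s \<in> ?C \<union> ?L"
    then show "\<exists>a\<in>?C. (s, a) \<in> (plus_steps (?C \<union> ?L))\<^sup>*"
    proof
      assume "s \<in> ?L"
      then obtain a where "a \<in> ?C" "plus_adjacent s a"
        unfolding vacant_boundary_def by blast
      then have "(s, a) \<in> plus_steps (?C \<union> ?L)"
        using \<open>s \<in> ?L\<close> unfolding plus_steps_def by blast
      then show ?thesis using \<open>a \<in> ?C\<close> by blast
    qed blast
  qed blast
  moreover have "finite (?C \<union> ?L)"
    using assms(2) finite_vacant_boundary by blast
  ultimately obtain F where F: "finite F" "?C \<union> ?L \<subseteq> F" "plus_connected F" "plus_connected (- F)"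
    "\<And>s t. s \<in> F \<Longrightarrow> t \<notin> F \<Longrightarrow> plus_adjacent s t \<Longrightarrow> s \<in> ?C \<union> ?L"
    using hole_filling by metis
  have "s \<in> ?L" if "s \<in> F" "t \<notin> F" "plus_adjacent s t" for s t
    using F(5)[OF that] C(4)[of s t] that F(2) by blast
  then show ?thesis using F by blast
qed

section \<open>Crosscuts\<close>

text \<open>
  Here \<open>u k\<close> is the tile of \<open>F\<close> at the \<open>k\<close>-th edge of the boundary cycle, and \<open>C\<close> is a connected
  set of tiles of \<open>F\<close> to which each \<open>u k\<close> is adjacent. When \<open>u i\<close> and \<open>u j\<close> have a common
  corner, the edges strictly between the \<open>i\<close>-th and the \<open>j\<close>-th one, together with sides of \<open>u i\<close>
  and \<open>u j\<close>, form a closed trail. Neither \<open>C\<close> nor the complement of \<open>F\<close> crosses this trail. For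
  a tile \<open>u k\<close> other than \<open>u i\<close> and \<open>u j\<close>, the way from \<open>C\<close> through \<open>u k\<close> and its boundary edge
  into the complement crosses the trail iff this edge is on the chosen arc. Whether \<open>C\<close> and the
  complement are on different sides does not depend on \<open>k\<close>, so all such \<open>k\<close> belong to the same
  arc.
\<close>

lemma crosscut:
  fixes vs :: "complex list" and u :: "nat \<Rightarrow> square"
  defines "n \<equiv> length vs"
  assumes vs: "distinct vs" "3 \<le> n" "boundary_edges F = closed_path_edges vs"
    and outer: "plus_connected (- F)"
    and C: "plus_connected C" "C \<subseteq> F"
    and u: "\<And>k. k < n \<Longrightarrow> u k \<in> F - C \<and> cycle_edge vs k \<in> edges (u k) \<and> (\<exists>c\<in>C. plus_adjacent (u k) c)"
    and ij: "i < j" "j < n" "corners (u i) \<inter> corners (u j) \<noteq> {}"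
  shows "(\<forall>k. i < k \<and> k < j \<longrightarrow> u k \<in> {u i, u j}) \<or> (\<forall>k<n. k < i \<or> j < k \<longrightarrow> u k \<in> {u i, u j})"
proof -
  let ?e = "cycle_edge vs"
  let ?P = "edges (u i) \<union> edges (u j)"
  have lattice: "closed_path_edges vs \<subseteq> graph_edges UNIV"
    using vs(3) boundary_edges_subset[of F] graph_edges_mono[of F UNIV] by blast
  have inj: "inj_on ?e {..<n}"
    using cycle_edge_inj vs(1,2) unfolding n_def by blast
  have e_bd: "?e k \<in> boundary_edges F" if "k < n" for k
    using that vs(3) unfolding closed_path_edges_eq n_def by blast
  have arc: "trail (vs ! Suc i) (map ?e [Suc i..<j]) (vs ! j)"
    using cycle_trail[OF lattice, of "Suc i" j] ij(1,2) unfolding n_def by simp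
  have "vs ! Suc i \<in> ?e i" "vs ! j \<in> ?e j"
    using ij(1,2) unfolding n_def by (simp_all add: cycle_edge_def)
  moreover have "i < n" using ij by linarith
  ultimately have ends: "vs ! Suc i \<in> corners (u i)" "vs ! j \<in> corners (u j)"
    using u[of i] u[of j] ij(2) edge_subset_corners by blast+
  obtain v where v: "v \<in> corners (u i)" "v \<in> corners (u j)"
    using ij(3) by blast
  obtain es1 where es1: "trail (vs ! j) es1 v" "set es1 \<subseteq> edges (u j)"
    using trail_in_square[OF ends(2) v(2)] by blast
  obtain es2 where es2: "trail v es2 (vs ! Suc i)" "set es2 \<subseteq> edges (u i)"
    using trail_in_square[OF v(1) ends(1)] by blast
  let ?W = "map ?e [Suc i..<j] @ es1 @ es2"
  have "trail (vs ! Suc i) ?W (vs ! Suc i)"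
    by (rule trail_append[OF arc trail_append[OF es1(1) es2(1)]])
  from closed_trail_separates[OF this] obtain I where
    I: "\<forall>s t e. e \<in> edges s \<longrightarrow> e \<in> edges t \<longrightarrow> s \<noteq> t \<longrightarrow>
      ((s \<in> I \<longleftrightarrow> t \<in> I) \<longleftrightarrow> even (count_list ?W e))" ..
  have "{Suc i..<j} \<subseteq> {..<n}"
    using ij(2) by auto
  from inj_on_subset[OF inj this] have "distinct (map ?e [Suc i..<j])"
    by (simp add: distinct_map)
  then have count: "even (count_list ?W e) \<longleftrightarrow> e \<notin> ?e ` {Suc i..<j}" if "e \<notin> ?P" for e
  proof -
    have "e \<notin> set es1" "e \<notin> set es2"
      using that es1(2) es2(2) by blast+
    then have "count_list es1 e = 0" "count_list es2 e = 0"
      by (simp_all add: count_list_0_iff)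
    then show ?thesis
      using \<open>distinct (map ?e [Suc i..<j])\<close> by (simp add: count_list_distinct)
  qed
  have sep: "(s \<in> I \<longleftrightarrow> t \<in> I) \<longleftrightarrow> e \<notin> ?e ` {Suc i..<j}"
    if "e \<in> edges s" "e \<in> edges t" "s \<noteq> t" "e \<notin> ?P" for s t e
    using I count that by blast
  have arc_bd: "?e ` {Suc i..<j} \<subseteq> boundary_edges F"
    using e_bd ij(2) by auto
  have uij: "u i \<in> F - C" "u j \<in> F - C"
    using u \<open>i < n\<close> ij(2) by blast+
  \<comment> \<open>A step between two tiles on the same side of the boundary crosses the trail only at \<open>u i\<close> or \<open>u j\<close>.\<close>
  have same_side: "s \<in> I \<longleftrightarrow> t \<in> I"
    if st: "plus_adjacent s t" "s \<in> F \<longleftrightarrow> t \<in> F" "{s, t} \<inter> {u i, u j} = {}" for s t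
  proof -
    obtain e where e: "e \<in> edges s" "e \<in> edges t" "s \<noteq> t"
      using st(1) by (rule plus_adjacentE)
    have "e \<notin> boundary_edges F"
      using edge_on_two_squares[OF e] st(2) by (blast elim: boundary_edgesE)
    moreover have "e \<notin> ?P"
      using edge_on_two_squares[OF e] st(3) by blast
    ultimately show ?thesis
      using sep[OF e] arc_bd by blast
  qed
  have const: "s \<in> I \<longleftrightarrow> t \<in> I" if "plus_connected X" "X = C \<or> X = - F" "s \<in> X" "t \<in> X" for X s t
    using that(1)
  proof (rule plus_connected_invariant[where s = s and P = "\<lambda>r. s \<in> I \<longleftrightarrow> r \<in> I"])
    fix r r' assume "r \<in> X" "r' \<in> X" "plus_adjacent r r'" "s \<in> I \<longleftrightarrow> r \<in> I"
    moreover from this have "r \<in> I \<longleftrightarrow> r' \<in> I"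
      using that(2) uij C(2) by (intro same_side) auto
    ultimately show "s \<in> I \<longleftrightarrow> r' \<in> I" by blast
  qed (use that in simp_all)
  obtain c0 where c0: "c0 \<in> C" using u \<open>i < n\<close> by blast
  obtain o0 where o0: "o0 \<notin> F" using e_bd[OF \<open>i < n\<close>] by (blast elim: boundary_edgesE)
  have key: "(c0 \<in> I \<longleftrightarrow> o0 \<in> I) \<longleftrightarrow> \<not> (i < k \<and> k < j)" if k: "k < n" "u k \<notin> {u i, u j}" for k
  proof -
    obtain c where c: "c \<in> C" "plus_adjacent (u k) c" using u k(1) by blast
    have "u k \<in> I \<longleftrightarrow> c \<in> I"
      using c k u uij C(2) by (intro same_side) auto
    moreover have "c \<in> I \<longleftrightarrow> c0 \<in> I"
      using const[OF C(1)] c(1) c0 by blast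
    moreover obtain t where t: "t \<notin> F" "?e k \<in> edges t"
      using e_bd[OF k(1)] by (blast elim: boundary_edgesE)
    have uk: "u k \<in> F" "?e k \<in> edges (u k)" using u k(1) by blast+
    then have "u k \<noteq> t" using t(1) by blast
    have "?e k \<notin> edges r" if "r \<in> F" "u k \<noteq> r" for r
      using edge_on_two_squares[OF uk(2) t(2) \<open>u k \<noteq> t\<close>, of r] that t(1) by auto
    then have "?e k \<notin> ?P"
      using k(2) uij by simp
    then have "(u k \<in> I \<longleftrightarrow> t \<in> I) \<longleftrightarrow> ?e k \<notin> ?e ` {Suc i..<j}"
      using sep[OF uk(2) t(2) \<open>u k \<noteq> t\<close>] by blast
    moreover have "?e k \<in> ?e ` {Suc i..<j} \<longleftrightarrow> k \<in> {Suc i..<j}"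
      using inj k(1) ij(2) by (intro inj_on_image_mem_iff[of ?e "{..<n}"]) auto
    moreover have "t \<in> I \<longleftrightarrow> o0 \<in> I"
      using const[OF outer] t(1) o0 by blast
    ultimately show ?thesis
      by (simp add: Suc_le_eq)
  qed
  show ?thesis
  proof (cases "c0 \<in> I \<longleftrightarrow> o0 \<in> I")
    case True
    then have "u k \<in> {u i, u j}" if "i < k" "k < j" for k
      using key[of k] that ij(2) by (meson order.strict_trans)
    then show ?thesis by blast
  next
    case False
    then have "u k \<in> {u i, u j}" if "k < n" "k < i \<or> j < k" for k
      using key[of k] that by (meson order.asym)
    then show ?thesis by blast
  qed
qed

section \<open>Chordless cycles as lists\<close>

text \<open>
  The sequence \<open>u\<close> is read cyclically. The hypothesis on arcs says that equal or related entries
  split the cyclic sequence into two arcs, one of which has no values other than theirs. For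
  equal entries this makes the occurrences of a value contiguous, so that removing adjacent
  duplicates removes all of them; for related entries it excludes values in between. The
  condition \<open>u (n - 1) \<noteq> u 0\<close> makes the list break between two different values.
\<close>

lemma remdups_adj_chordless:
  fixes u :: "nat \<Rightarrow> 'a" and R :: "'a \<Rightarrow> 'a \<Rightarrow> bool"
  assumes "0 < n"
    and step: "\<And>k. Suc k < n \<Longrightarrow> u k = u (Suc k) \<or> R (u k) (u (Suc k))"
    and close: "u (n - 1) \<noteq> u 0" "R (u (n - 1)) (u 0)"
    and arcs: "\<And>i j. i < j \<Longrightarrow> j < n \<Longrightarrow> u i = u j \<or> R (u i) (u j) \<Longrightarrow>
      (\<forall>k. i < k \<and> k < j \<longrightarrow> u k \<in> {u i, u j}) \<or> (\<forall>k<n. k < i \<or> j < k \<longrightarrow> u k \<in> {u i, u j})"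
  defines "H \<equiv> remdups_adj (map u [0..<n])"
  shows "distinct H" "successively R H" "R (last H) (hd H)"
    and "\<And>a b. a < b \<Longrightarrow> b < length H \<Longrightarrow> R (H ! a) (H ! b) \<Longrightarrow> b = Suc a \<or> a = 0 \<and> b = length H - 1"
proof -
  obtain f :: "nat \<Rightarrow> nat" where f: "mono f" "f ` {0..<n} = {0..<length H}"
      "\<And>i. i < n \<Longrightarrow> u i = H ! f i"
      "\<And>i. Suc i < n \<Longrightarrow> u i = u (Suc i) \<longleftrightarrow> f i = f (Suc i)"
  proof -
    have "\<exists>f::nat \<Rightarrow> nat. mono f \<and> f ` {0..<length (map u [0..<n])} = {0..<length H}
      \<and> (\<forall>i < length (map u [0..<n]). map u [0..<n] ! i = H ! f i)
      \<and> (\<forall>i. i + 1 < length (map u [0..<n]) \<longrightarrow> (map u [0..<n] ! i = map u [0..<n] ! (i+1) \<longleftrightarrow> f i = f (i+1)))"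
      using remdups_adj_altdef[of "map u [0..<n]" H] H_def by blast
    then show thesis using that by auto
  qed
  have less: "i < j" if "f i < f j" for i j
    using that monoD[OF f(1), of j i] by (cases "i < j") auto
  have rep: "\<exists>i<n. f i = a" if "a < length H" for a
  proof -
    have "a \<in> f ` {0..<n}" using that f(2) by simp
    then show ?thesis by auto
  qed
  show dist: "distinct H"
    unfolding distinct_conv_nth
  proof (intro allI impI)
    have "H ! a \<noteq> H ! b" if ab: "a < b" "b < length H" for a b
    proof
      assume eq: "H ! a = H ! b"
      obtain i j where ij: "i < n" "j < n" "f i = a" "f j = b"
        using rep[of a] rep[of b] ab by auto
      then have "i < j" "u i = u j"
        using ab less[of i j] eq f(3) by auto
      with arcs[of i j] ij consider "\<And>k. i < k \<Longrightarrow> k < j \<Longrightarrow> u k = u i"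
        | "\<And>k. k < n \<Longrightarrow> k < i \<or> j < k \<Longrightarrow> u k = u i"
        by auto
      then show False
      proof cases
        case 1
        have "f k = f i" if "i \<le> k" "k \<le> j" for k
          using that
        proof (induction k rule: dec_induct)
          case (step k)
          have "u k = u i" using 1[of k] step by (cases "k = i") auto
          moreover have "u (Suc k) = u i" using 1[of "Suc k"] step \<open>u i = u j\<close> by (cases "Suc k = j") auto
          ultimately show ?case using f(4)[of k] step ij by auto
        qed simp
        from this[of j] show False using \<open>i < j\<close> ij ab by simp
      next
        case 2
        have "u 0 = u i" using 2[of 0] assms(1) by (cases "i = 0") auto
        moreover have "u (n - 1) = u i"
        proof (cases "j < n - 1")
          case True
          then show ?thesis using 2[of "n - 1"] assms(1) by simp
        next
          case False
          then have "j = n - 1" using ij by linarith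
          then show ?thesis using \<open>u i = u j\<close> by simp
        qed
        ultimately show False using close by simp
      qed
    qed
    then show "H ! a \<noteq> H ! b" if "a < length H" "b < length H" "a \<noteq> b" for a b
      using that by (metis linorder_neqE_nat)
  qed
  have "successively (\<lambda>x y. x = y \<or> R x y) (map u [0..<n])"
    using step by (simp add: successively_conv_nth)
  then have "successively (\<lambda>x y. x = y \<or> R x y) H"
    unfolding H_def by (rule successively_remdups_adjI)
  then show "successively R H"
    using remdups_adj_adjacent[of _ "map u [0..<n]"] unfolding H_def successively_conv_nth by blast
  show "R (last H) (hd H)"
    using close(2) assms(1) by (simp add: H_def last_map hd_map)
  fix a b assume ab: "a < b" "b < length H" "R (H ! a) (H ! b)"
  obtain i j where ij: "i < n" "j < n" "f i = a" "f j = b"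
    using rep[of a] rep[of b] ab by auto
  have "i < j" using ab less[of i j] ij by simp
  have "H \<noteq> []" using ab by auto
  have avoid: "H ! c \<notin> {H ! a, H ! b}" if "c < length H" "c \<noteq> a" "c \<noteq> b" for c
    using that ab nth_eq_iff_index_eq[OF dist] by auto
  from arcs[OF \<open>i < j\<close> \<open>j < n\<close>] ab(3) f(3) ij
  consider "\<And>k. i < k \<Longrightarrow> k < j \<Longrightarrow> H ! f k \<in> {H ! a, H ! b}"
    | "\<And>k. k < n \<Longrightarrow> k < i \<or> j < k \<Longrightarrow> H ! f k \<in> {H ! a, H ! b}"
    by (metis order.strict_trans)
  then show "b = Suc a \<or> a = 0 \<and> b = length H - 1"
  proof cases
    case 1
    have "b = Suc a"
    proof (rule ccontr)
      assume "b \<noteq> Suc a"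
      then obtain k where "k < n" "f k = Suc a"
        using rep[of "Suc a"] ab by (metis Suc_lessI less_trans)
      then show False
        using 1[of k] less[of i k] less[of k j] ij ab \<open>b \<noteq> Suc a\<close> avoid[of "Suc a"] by auto
    qed
    then show ?thesis ..
  next
    case 2
    have "a = 0"
    proof (rule ccontr)
      assume "a \<noteq> 0"
      obtain k where "k < n" "f k = 0"
        using rep[of 0] ab by (metis gr_implies_not_zero neq0_conv)
      then show False
        using 2[of k] less[of k i] ij ab \<open>a \<noteq> 0\<close> avoid[of 0] \<open>H \<noteq> []\<close> by auto
    qed
    moreover have "b = length H - 1"
    proof (rule ccontr)
      assume "b \<noteq> length H - 1"
      with ab have last: "b < length H - 1" "a \<noteq> length H - 1" "length H - 1 < length H"
        by linarith+
      obtain k where "k < n" "f k = length H - 1"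
        using rep[of "length H - 1"] ab by (metis diff_less gr_implies_not_zero neq0_conv zero_less_one)
      then show False
        using 2[of k] less[of j k] ij ab last avoid[of "length H - 1"] by auto
    qed
    ultimately show ?thesis by blast
  qed
qed

text \<open>
  A vertex of \<open>P\<close> is related to its two cyclic neighbours only. After a step of \<open>Q\<close> in one
  direction, \<open>Q\<close> must go on in this direction, as the other neighbour has just been visited.
\<close>

lemma hamiltonian_cycle_forced:
  assumes "distinct P" "distinct Q" "length Q = length P" "successively R Q"
    and nbr: "\<And>a b. a < length P \<Longrightarrow> b < length P \<Longrightarrow> R (P ! a) (P ! b) \<Longrightarrow>
      b = Suc a mod length P \<or> a = Suc b mod length P"
    and "set Q = set P"
    and start: "Suc 0 < length Q" "a < length P" "Q ! 0 = P ! a" "Q ! 1 = P ! (Suc a mod length P)"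
  shows "Q = rotate a P"
proof (rule nth_equalityI)
  let ?m = "length P"
  have m: "0 < ?m" using start by linarith
  show "length Q = length (rotate a P)" using assms(3) by simp
  have *: "Q ! k = P ! ((a + k) mod ?m) \<and> (Suc k < ?m \<longrightarrow> Q ! Suc k = P ! ((a + Suc k) mod ?m))"
    if "k < ?m" for k
    using that
  proof (induction k)
    case 0
    then show ?case using start by simp
  next
    case (Suc k)
    have IH: "Q ! k = P ! ((a + k) mod ?m)" "Q ! Suc k = P ! ((a + Suc k) mod ?m)"
      using Suc by auto
    have "Q ! Suc (Suc k) = P ! ((a + Suc (Suc k)) mod ?m)" if lt: "Suc (Suc k) < ?m"
    proof -
      have "Q ! Suc (Suc k) \<in> set P"
        using lt assms(3,6) nth_mem[of "Suc (Suc k)" Q] by simp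
      then obtain b where b: "b < ?m" "P ! b = Q ! Suc (Suc k)"
        by (auto simp: in_set_conv_nth)
      have "R (Q ! Suc k) (Q ! Suc (Suc k))"
        using assms(3,4) lt by (simp add: successively_conv_nth)
      then have "R (P ! ((a + Suc k) mod ?m)) (P ! b)"
        using IH b by simp
      then consider "b = Suc ((a + Suc k) mod ?m) mod ?m" | "(a + Suc k) mod ?m = Suc b mod ?m"
        using nbr[of "(a + Suc k) mod ?m" b] b m by auto
      then show ?thesis
      proof cases
        case 1
        then have "b = (a + Suc (Suc k)) mod ?m" by (simp add: mod_Suc_eq)
        then show ?thesis using b by simp
      next
        case 2
        then have "(Suc (a + k)) mod ?m = Suc b mod ?m" by simp
        then have "(a + k) mod ?m = b mod ?m"
          by (auto simp: mod_Suc split: if_splits)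
        \<comment> \<open>Turning back would repeat the entry before the last one.\<close>
        then have "P ! b = Q ! k" using IH b by simp
        then have "Q ! Suc (Suc k) = Q ! k" using b by simp
        then show ?thesis
          using nth_eq_iff_index_eq[OF assms(2)] lt assms(3) by simp
      qed
    qed
    then show ?case using IH by simp
  qed
  show "Q ! k = rotate a P ! k" if "k < length Q" for k
    using *[of k] that assms(3) by (simp add: nth_rotate)
qed

text \<open>
  The second vertex of \<open>Q\<close> is one of the two cyclic neighbours of the first; in one case \<open>Q\<close>
  follows \<open>P\<close>, in the other one it follows the reversal of \<open>P\<close>.
\<close>

lemma hamiltonian_cycle_unique:
  assumes "distinct P" "distinct Q" "set Q = set P" "length P \<ge> 3" "successively R Q"
    and sym: "\<And>x y. R x y \<Longrightarrow> R y x" and irrefl: "\<And>x. \<not> R x x"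
    and chord: "\<And>a b. a < b \<Longrightarrow> b < length P \<Longrightarrow> R (P ! a) (P ! b) \<Longrightarrow>
      b = Suc a \<or> a = 0 \<and> b = length P - 1"
  shows "\<exists>k. Q = rotate k P \<or> Q = rotate k (rev P)"
proof -
  let ?m = "length P"
  have len: "length Q = ?m"
    using assms(1-3) distinct_card by metis
  have nbr: "b = Suc a mod ?m \<or> a = Suc b mod ?m"
    if "a < ?m" "b < ?m" "R (P ! a) (P ! b)" for a b
  proof -
    have "a \<noteq> b" using that irrefl by auto
    moreover have "b = Suc a mod ?m \<or> a = Suc b mod ?m" if "a < b" "b < ?m" "R (P ! a) (P ! b)" for a b
      using chord[OF that]
    proof
      assume "b = Suc a"
      then show ?thesis using that by simp
    next
      assume ab: "a = 0 \<and> b = ?m - 1"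
      then have "Suc b = ?m" using that by linarith
      then show ?thesis using ab by simp
    qed
    ultimately show ?thesis
      using that sym by (metis linorder_neqE_nat)
  qed
  have lt: "0 < length Q" "1 < length Q"
    using len assms(4) by linarith+
  obtain a where a: "a < ?m" "P ! a = Q ! 0"
    using nth_mem[OF lt(1)] unfolding assms(3) in_set_conv_nth by blast
  obtain b where b: "b < ?m" "P ! b = Q ! 1"
    using nth_mem[OF lt(2)] unfolding assms(3) in_set_conv_nth by blast
  have "R (Q ! 0) (Q ! 1)"
    using assms(4,5) len by (auto simp: successively_conv_nth)
  then have "b = Suc a mod ?m \<or> a = Suc b mod ?m"
    using nbr a b by simp
  then show ?thesis
  proof
    assume "b = Suc a mod ?m"
    then have "Q = rotate a P"
      using hamiltonian_cycle_forced[OF assms(1,2) len assms(5) nbr assms(3), of a] a b len assms(4) by auto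
    then show ?thesis by blast
  next
    assume ab: "a = Suc b mod ?m"
    define c where "c = ?m - 1 - a"
    have c: "c < ?m" "?m - 1 - c = a" "Suc c mod ?m = ?m - 1 - b"
      using a(1) b(1) ab by (auto simp: c_def mod_Suc split: if_splits)
    have rev_nth': "rev P ! k = P ! (?m - 1 - k)" if "k < ?m" for k
      using that by (simp add: rev_nth)
    \<comment> \<open>Reversal exchanges successors and predecessors.\<close>
    have mirror: "x = Suc y mod ?m" if "x < ?m" "y < ?m" "?m - 1 - y = Suc (?m - 1 - x) mod ?m" for x y
    proof (cases "x = 0")
      case True
      then have "Suc (?m - 1 - x) = ?m" using that by linarith
      then have "?m - 1 - y = 0" using that(3) by simp
      then have "Suc y = ?m" using that(2) by linarith
      then show ?thesis using True by simp
    next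
      case False
      then have "Suc (?m - 1 - x) < ?m" using that(1) by linarith
      then have "?m - 1 - y = Suc (?m - 1 - x)" using that(3) by simp
      then have "x = Suc y" using that(1,2) False by linarith
      then show ?thesis using that(1) by simp
    qed
    have "Q = rotate c (rev P)"
    proof (rule hamiltonian_cycle_forced[where R = R])
      fix k l assume kl: "k < length (rev P)" "l < length (rev P)" "R (rev P ! k) (rev P ! l)"
      then have "?m - 1 - l = Suc (?m - 1 - k) mod ?m \<or> ?m - 1 - k = Suc (?m - 1 - l) mod ?m"
        using nbr[of "?m - 1 - k" "?m - 1 - l"] rev_nth' by simp
      then show "l = Suc k mod length (rev P) \<or> k = Suc l mod length (rev P)"
        using mirror[of k l] mirror[of l k] kl(1,2) unfolding length_rev by blast
    next
      show "Q ! 0 = rev P ! c"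
        using rev_nth'[OF c(1)] c(2) a by simp
      have "Suc c mod ?m < ?m" using a(1) by (intro mod_less_divisor) linarith
      then show "Q ! 1 = rev P ! (Suc c mod length (rev P))"
        using rev_nth'[of "Suc c mod ?m"] c(3) b by simp
    qed (use assms len c in auto)
    then show ?thesis by blast
  qed
qed

section \<open>The cycle of boundary tiles\<close>

lemma cycle_edge_rotate:
  assumes "k < length vs"
  shows "cycle_edge (rotate m vs) k = cycle_edge vs ((m + k) mod length vs)"
proof -
  let ?n = "length vs"
  have "Suc k mod ?n < ?n" using assms by (intro mod_less_divisor) linarith
  moreover have "(m + Suc k mod ?n) mod ?n = Suc ((m + k) mod ?n) mod ?n"
    by (simp add: mod_add_right_eq mod_Suc_eq)
  ultimately show ?thesis
    using assms unfolding cycle_edge_def length_rotate by (simp add: nth_rotate)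
qed

lemma closed_path_edges_rotate:
  assumes "distinct vs" "length vs \<ge> 3"
  shows "closed_path_edges (rotate m vs) = closed_path_edges vs"
proof (rule card_subset_eq)
  show "finite (closed_path_edges vs)" by (rule finite_closed_path_edges)
  show "closed_path_edges (rotate m vs) \<subseteq> closed_path_edges vs"
  proof
    fix e assume "e \<in> closed_path_edges (rotate m vs)"
    then obtain k where k: "k < length vs" "e = cycle_edge (rotate m vs) k"
      unfolding closed_path_edges_eq by auto
    then have "e = cycle_edge vs ((m + k) mod length vs)"
      using cycle_edge_rotate by blast
    moreover have "(m + k) mod length vs < length vs"
      using k(1) by (intro mod_less_divisor) linarith
    ultimately show "e \<in> closed_path_edges vs"
      unfolding closed_path_edges_eq by blast
  qed
  \<comment> \<open>Equal cardinalities give the reverse inclusion, since both lists traverse distinct edges.\<close>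
  show "card (closed_path_edges (rotate m vs)) = card (closed_path_edges vs)"
    unfolding closed_path_edges_eq
    using cycle_edge_inj[of vs] cycle_edge_inj[of "rotate m vs"] assms by (simp add: card_image)
qed

lemma ray_leaves:
  fixes r :: "nat \<Rightarrow> square"
  assumes "finite F" "inj r" "r 0 \<in> F"
  shows "\<exists>m. r m \<in> F \<and> r (Suc m) \<notin> F"
proof (rule ccontr)
  assume no: "\<not> ?thesis"
  have "r m \<in> F" for m
    by (induction m) (use no assms(3) in auto)
  then have "range r \<subseteq> F" by blast
  then show False
    using assms(1) range_inj_infinite[OF assms(2)] finite_subset by blast
qed

definition boundary_squares :: "square set \<Rightarrow> square set" where
  "boundary_squares F = {s \<in> F. edges s \<inter> boundary_edges F \<noteq> {}}"

lemma boundary_squares_exit: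
  assumes "s \<in> F" "t \<notin> F" "plus_adjacent s t"
  shows "s \<in> boundary_squares F"
  using assms(3)
proof (rule plus_adjacentE)
  fix e assume "e \<in> edges s" "e \<in> edges t"
  then show ?thesis
    using assms unfolding boundary_squares_def boundary_edges_def by blast
qed

text \<open>
  Leaving \<open>F\<close> from the origin in three of the four axis directions passes through three
  different tiles on the boundary. This gives the minimal length of a star cycle.
\<close>

lemma three_boundary_squares:
  assumes "finite F" "(0, 0) \<in> F" "(0, 0) \<notin> boundary_squares F"
  shows "card (boundary_squares F) \<ge> 3"
proof -
  have exit: "\<exists>m > 0. r m \<in> boundary_squares F"
    if r: "inj r" "r 0 = (0, 0)" "\<And>m. plus_adjacent (r m) (r (Suc m))" for r :: "nat \<Rightarrow> square"
  proof -
    obtain m where "r m \<in> F" "r (Suc m) \<notin> F"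
      using ray_leaves[OF assms(1) r(1)] r(2) assms(2) by auto
    then have m: "r m \<in> boundary_squares F"
      using boundary_squares_exit r(3) by blast
    then have "m \<noteq> 0"
      using r(2) assms(3) by (intro notI) simp
    then show ?thesis using m by blast
  qed
  obtain a where a: "a > 0" "(int a, 0) \<in> boundary_squares F"
    using exit[of "\<lambda>m. (int m, 0)"] by (auto simp: inj_def plus_adjacent_iff)
  obtain b where b: "b > 0" "(0, int b) \<in> boundary_squares F"
    using exit[of "\<lambda>m. (0, int m)"] by (auto simp: inj_def plus_adjacent_iff)
  obtain c where c: "c > 0" "(0, - int c) \<in> boundary_squares F"
    using exit[of "\<lambda>m. (0, - int m)"] by (auto simp: inj_def plus_adjacent_iff)
  have "card {(int a, 0), (0, int b), (0, - int c)} = 3"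
    using a b c by simp
  moreover have "finite (boundary_squares F)"
    using assms(1) unfolding boundary_squares_def by simp
  then have "card {(int a, 0), (0, int b), (0, - int c)} \<le> card (boundary_squares F)"
    using a b c by (intro card_mono) auto
  ultimately show ?thesis by simp
qed

definition inner_square :: "square set \<Rightarrow> edge \<Rightarrow> square" where
  "inner_square F e = (SOME s. s \<in> F \<and> e \<in> edges s)"

lemma inner_square:
  assumes "e \<in> boundary_edges F"
  shows "inner_square F e \<in> F" "e \<in> edges (inner_square F e)"
    and "\<And>s. s \<in> F \<Longrightarrow> e \<in> edges s \<Longrightarrow> s = inner_square F e"
proof -
  obtain s t where st: "s \<in> F" "t \<notin> F" "e \<in> edges s" "e \<in> edges t"
    using assms by (rule boundary_edgesE)
  then have "\<exists>s. s \<in> F \<and> e \<in> edges s" by blast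
  from someI_ex[OF this] show *: "inner_square F e \<in> F" "e \<in> edges (inner_square F e)"
    unfolding inner_square_def by blast+
  fix r assume "r \<in> F" "e \<in> edges r"
  moreover have "inner_square F e \<noteq> t" using * st by blast
  ultimately show "r = inner_square F e"
    using edge_on_two_squares[OF *(2) st(4), of r] st(2) by blast
qed

lemma boundary_squares_eq: "boundary_squares F = inner_square F ` boundary_edges F"
proof (intro set_eqI iffI)
  fix s assume "s \<in> boundary_squares F"
  then obtain e where "s \<in> F" "e \<in> edges s" "e \<in> boundary_edges F"
    unfolding boundary_squares_def by blast
  then show "s \<in> inner_square F ` boundary_edges F"
    using inner_square(3) by blast
next
  fix s assume "s \<in> inner_square F ` boundary_edges F"
  then show "s \<in> boundary_squares F"
    using inner_square(1,2) unfolding boundary_squares_def by blast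
qed

text \<open>
  The traversal starts at a place where the inner tile changes, so that the cyclic sequence of
  inner tiles is not broken inside a run of equal tiles.
\<close>

lemma boundary_traversal:
  assumes "finite F" "plus_connected F" "plus_connected (- F)" "(0, 0) \<in> F" "(0, 0) \<notin> boundary_squares F"
  obtains vs where "distinct vs" "length vs \<ge> 3" "boundary_edges F = closed_path_edges vs"
    "inner_square F (cycle_edge vs (length vs - 1)) \<noteq> inner_square F (cycle_edge vs 0)"
proof -
  obtain vs where vs: "length vs \<ge> 3" "distinct vs" "boundary_edges F = closed_path_edges vs"
    using boundary_is_simple_cycle[OF assms(1) _ assms(2,3)] assms(4) by blast
  let ?n = "length vs" and ?u = "\<lambda>k. inner_square F (cycle_edge vs k)"
  have "\<exists>k. Suc k < ?n \<and> ?u k \<noteq> ?u (Suc k)"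
  proof (rule ccontr)
    assume "\<not> ?thesis"
    then have const: "?u k = ?u 0" if "k < ?n" for k
      using that
    proof (induction k)
      case (Suc k)
      then have "?u k = ?u (Suc k)" by blast
      then show ?case using Suc by simp
    qed simp
    have "boundary_squares F \<subseteq> {?u 0}"
    proof
      fix s assume "s \<in> boundary_squares F"
      then obtain k where "k < ?n" "s = ?u k"
        unfolding boundary_squares_eq vs(3) closed_path_edges_eq by blast
      then show "s \<in> {?u 0}" using const by blast
    qed
    then have "card (boundary_squares F) \<le> 1"
      using card_mono[of "{?u 0}" "boundary_squares F"] by simp
    then show False
      using three_boundary_squares[OF assms(1,4,5)] by simp
  qed
  then obtain k where k: "Suc k < ?n" "?u k \<noteq> ?u (Suc k)" by blast
  let ?vs = "rotate (Suc k) vs"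
  show thesis
  proof (rule that[of ?vs])
    have "cycle_edge ?vs 0 = cycle_edge vs (Suc k)"
      using k(1) by (subst cycle_edge_rotate) auto
    moreover have "cycle_edge ?vs (?n - 1) = cycle_edge vs k"
    proof -
      have "Suc k + (?n - 1) = k + ?n" using k(1) by linarith
      then show ?thesis
        using k(1) by (subst cycle_edge_rotate) auto
    qed
    ultimately show "inner_square F (cycle_edge ?vs (length ?vs - 1)) \<noteq> inner_square F (cycle_edge ?vs 0)"
      using k(2) by simp
    show "boundary_edges F = closed_path_edges ?vs"
      using closed_path_edges_rotate[OF vs(2,1), of "Suc k"] vs(3) by (rule trans[OF _ sym, rotated])
  qed (use vs in simp_all)
qed

lemma boundary_squares_cycle:
  assumes F: "finite F" "plus_connected F" "plus_connected (- F)"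
    and C: "plus_connected C" "C \<subseteq> F" "(0, 0) \<in> C"
    and bdry: "\<And>s. s \<in> boundary_squares F \<Longrightarrow> s \<notin> C \<and> (\<exists>c\<in>C. plus_adjacent s c)"
  shows "\<exists>H. star_cycle H \<and> set H = boundary_squares F \<and>
    (\<forall>a b. a < b \<longrightarrow> b < length H \<longrightarrow> star_adjacent (H ! a) (H ! b) \<longrightarrow> b = Suc a \<or> a = 0 \<and> b = length H - 1)"
proof -
  have origin: "(0, 0) \<in> F" "(0, 0) \<notin> boundary_squares F"
    using C bdry by blast+
  obtain vs where vs: "distinct vs" "length vs \<ge> 3" "boundary_edges F = closed_path_edges vs"
    "inner_square F (cycle_edge vs (length vs - 1)) \<noteq> inner_square F (cycle_edge vs 0)"
    using boundary_traversal[OF F origin] by blast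
  define n where "n = length vs"
  define u where "u k = inner_square F (cycle_edge vs k)" for k
  have e_bd: "cycle_edge vs k \<in> boundary_edges F" if "k < n" for k
    using that vs(3) unfolding closed_path_edges_eq n_def by blast
  have u: "u k \<in> F - C \<and> cycle_edge vs k \<in> edges (u k) \<and> (\<exists>c\<in>C. plus_adjacent (u k) c)" if "k < n" for k
  proof -
    have "u k \<in> boundary_squares F"
      using e_bd[OF that] unfolding boundary_squares_eq u_def by blast
    then show ?thesis
      using bdry inner_square(1,2)[OF e_bd[OF that]] unfolding u_def by blast
  qed
  have adj: "u k = u l \<or> star_adjacent (u k) (u l)" if "k < n" "l = Suc k mod n" "l < n" for k l
  proof -
    have "vs ! l \<in> cycle_edge vs k" "vs ! l \<in> cycle_edge vs l"
      using that unfolding cycle_edge_def n_def by simp_all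
    then have "vs ! l \<in> corners (u k)" "vs ! l \<in> corners (u l)"
      using u that edge_subset_corners by blast+
    then show ?thesis
      unfolding star_adjacent_def by blast
  qed
  have pos: "0 < n" using vs(2) unfolding n_def by linarith
  have close: "u (n - 1) \<noteq> u 0"
    using vs(4) unfolding u_def n_def .
  then have close': "star_adjacent (u (n - 1)) (u 0)"
    using adj[of "n - 1" 0] pos by simp
  have step: "u k = u (Suc k) \<or> star_adjacent (u k) (u (Suc k))" if "Suc k < n" for k
    using adj[of k "Suc k"] that by simp
  have arcs: "(\<forall>k. i < k \<and> k < j \<longrightarrow> u k \<in> {u i, u j}) \<or> (\<forall>k<n. k < i \<or> j < k \<longrightarrow> u k \<in> {u i, u j})"
    if "i < j" "j < n" "u i = u j \<or> star_adjacent (u i) (u j)" for i j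
  proof -
    have "corners (u i) \<noteq> {}" by (cases "u i") simp
    then have "corners (u i) \<inter> corners (u j) \<noteq> {}"
      using that(3) unfolding star_adjacent_def by auto
    then show ?thesis
      using crosscut[of vs F C u i j] vs(1-3) F(3) C(1,2) u that(1,2) unfolding n_def by blast
  qed
  define H where "H = remdups_adj (map u [0..<n])"
  note H = remdups_adj_chordless[OF pos step close close' arcs, folded H_def]
  have "set H = u ` {..<n}"
    by (simp add: H_def atLeast0LessThan)
  then have set_H: "set H = boundary_squares F"
    unfolding boundary_squares_eq vs(3) closed_path_edges_eq u_def n_def by (simp add: image_image)
  then have "length H \<ge> 3"
    using three_boundary_squares[OF F(1) origin] distinct_card[OF H(1)] by simp
  then have "star_cycle H"
    using H(1-3) unfolding star_cycle_def star_path_def by blast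
  then show ?thesis
    using set_H H(4) by blast
qed

section \<open>Existence and uniqueness\<close>

theorem theorem3:
  fixes occ :: "square set"
  assumes "(0, 0) \<in> occ"
    and "finite (plus_component occ)"
  shows "\<exists>H. outer_vacant_cycle occ H \<and>
             (\<forall>H'. outer_vacant_cycle occ H' \<longrightarrow> same_cycle H H')"
proof -
  let ?C = "plus_component occ" and ?L = "vacant_boundary occ"
  note C = plus_component_facts[OF assms(1)]
  obtain F where F: "finite F" "plus_connected F" "plus_connected (- F)" "?C \<union> ?L \<subseteq> F"
    and inner: "\<And>s t. s \<in> F \<Longrightarrow> t \<notin> F \<Longrightarrow> plus_adjacent s t \<Longrightarrow> s \<in> ?L"
    using cluster_filling[OF assms] by blast
  let ?D = "boundary_edges F"
  have bdry: "boundary_squares F \<subseteq> ?L"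
  proof
    fix s assume "s \<in> boundary_squares F"
    then obtain e where e: "s \<in> F" "e \<in> edges s" "e \<in> ?D"
      unfolding boundary_squares_def by blast
    from e(3) obtain t where "t \<notin> F" "e \<in> edges t" by (rule boundary_edgesE)
    then show "s \<in> ?L"
      using inner[OF e(1)] plus_adjacentI[OF e(2)] e(1) by blast
  qed
  have L: "s \<notin> ?C \<and> (\<exists>c\<in>?C. plus_adjacent s c)" if "s \<in> ?L" for s
    using that C(2) unfolding vacant_boundary_def by blast
  then have "s \<notin> ?C \<and> (\<exists>c\<in>?C. plus_adjacent s c)" if "s \<in> boundary_squares F" for s
    using bdry that by blast
  moreover have "?C \<subseteq> F" using F(4) by blast
  ultimately have "\<exists>H. star_cycle H \<and> set H = boundary_squares F \<and>
    (\<forall>a b. a < b \<longrightarrow> b < length H \<longrightarrow> star_adjacent (H ! a) (H ! b) \<longrightarrow> b = Suc a \<or> a = 0 \<and> b = length H - 1)"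
    by (intro boundary_squares_cycle[OF F(1-3) C(3) _ C(1)])
  then obtain H where H_all: "star_cycle H \<and> set H = boundary_squares F \<and>
    (\<forall>a b. a < b \<longrightarrow> b < length H \<longrightarrow> star_adjacent (H ! a) (H ! b) \<longrightarrow> b = Suc a \<or> a = 0 \<and> b = length H - 1)"
    ..
  then have H: "star_cycle H" "set H = boundary_squares F"
    by (rule conjunct1, rule conjunct2[THEN conjunct1])
  have chord: "b = Suc a \<or> a = 0 \<and> b = length H - 1"
    if "a < b" "b < length H" "star_adjacent (H ! a) (H ! b)" for a b
    using H_all[THEN conjunct2, THEN conjunct2, rule_format, OF that] .
  have D_cycle: "\<exists>vs. length vs \<ge> 3 \<and> distinct vs \<and> ?D = closed_path_edges vs"
    using boundary_is_simple_cycle[OF F(1) _ F(2,3)] C(1) F(4) by blast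
  have D_sub: "?D \<subseteq> graph_edges (boundary_squares F)"
    unfolding boundary_squares_def graph_edges_def by (blast elim: boundary_edgesE)
  have cycle: "is_cycle (set H) ?D"
    using D_cycle D_sub unfolding is_cycle_def H(2) by blast
  have sub_F: "set H \<subseteq> F"
    using H(2) unfolding boundary_squares_def by blast
  have outermost: "outermost_boundary (set H) = ?D"
    using outermost_boundary_eq[OF F(1,3) sub_F cycle] .
  have "outer_vacant_cycle occ H"
    unfolding outer_vacant_cycle_def outermost Let_def
    using H bdry cycle boundary_encloses[OF F(1)] F(4) unfolding boundary_squares_def by blast
  moreover have "same_cycle H H'" if "outer_vacant_cycle occ H'" for H'
  proof -
    let ?B = "outermost_boundary (set H')"
    have H': "star_cycle H'" "set H' \<subseteq> ?L" "is_cycle (set H') ?B"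
        "\<And>s. s \<in> set H' \<Longrightarrow> edges s \<inter> ?B \<noteq> {}" "\<And>s. s \<in> ?L \<Longrightarrow> square_in_interior ?B s"
      using that unfolding outer_vacant_cycle_def Let_def by blast+
    have B: "?B = ?D"
    proof (rule outermost_boundary_determined[OF F(1,3) _ H'(3) D_cycle])
      show "set H' \<subseteq> F" using H'(2) F(4) by blast
      show "square_in_interior ?B s" if "s \<in> F" "t \<notin> F" "plus_adjacent s t" for s t
        using H'(5) inner[OF that] by blast
    qed
    \<comment> \<open>Every boundary edge of \<open>F\<close> is a side of a tile of \<open>H'\<close>, and it is a side of only one tile of \<open>F\<close>.\<close>
    have "set H' = set H"
    proof
      show "set H' \<subseteq> set H"
        using H'(2,4) F(4) unfolding B H(2) boundary_squares_def by blast
      show "set H \<subseteq> set H'"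
      proof
        fix s assume "s \<in> set H"
        then obtain e where e: "s \<in> F" "e \<in> edges s" "e \<in> ?D"
          unfolding H(2) boundary_squares_def by blast
        then obtain t where t: "t \<in> set H'" "e \<in> edges t"
          using is_cycle_subset[OF H'(3)] unfolding B graph_edges_def by blast
        then have "t \<in> F" using H'(2) F(4) by blast
        then have "s = t" using inner_square(3)[OF e(3)] e t by metis
        then show "s \<in> set H'" using t(1) by simp
      qed
    qed
    moreover have "distinct H" "length H \<ge> 3" "distinct H'" "successively star_adjacent H'"
      using H(1) H'(1) unfolding star_cycle_def star_path_def by blast+
    ultimately show ?thesis
      unfolding same_cycle_def
      using hamiltonian_cycle_unique[of H H' star_adjacent] star_adjacent_sym chord
      by (metis star_adjacent_def)
  qed
  ultimately show ?thesis by blast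
qed

end
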